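(* For any $\delta_\mu^{a},\delta_\pi^{a}\in[0,1/3)$ and positive integers $p,s$ with $s\le p$ and $s[\log(p/s)+1]\le n\le p^{1/3}$, there exist functions $\{\phi_j\}_{j=1}^p$ on $[0,1]^d$ with $\mathbb E_{X\sim\nu_d}[\phi(X)\phi(X)^\top]=I_p$ for $\phi(X)=(\phi_1(X),\dots,\phi_p(X))^\top\in\mathbb R^p$, such that the function classes $$\mathcal F_\mu=\mathcal G_{p,s}\cup\mathcal B(0,\delta_\mu^{a}),\qquad \mathcal F_\pi=\mathcal G_{p,s}\cup\mathcal B(0,\delta_\pi^{a}),$$ with $\mathcal G_{p,s}:=\{g(x)=\sum_{j=1}^p\alpha_j\phi_j(x)\in\mathcal T:\ \|\alpha\|_0\le s\}$ and $\mathcal B(g,\delta)=\{f\in\mathcal T:\ \|f-g\|_{L_2(\nu_d)}\le\delta\}$, satisfy $$\inf_{\hat\theta}\ \sup_{\mathbb P\in\mathcal P(\mathcal F_\mu,\mathcal F_\pi)}\mathbb E_{\mathbb P^{2n}}\bigl[|\hat\theta-\theta(\mathbb P)|\bigr]\ \ge\ \frac1{211}\Bigl[n^{-1/2}+\delta_\mu^{a}\,\delta_\pi^{a}+\frac{s\log(p)}n\Bigr].$$ Here the expectation $\mathbb E_{\mathbb P^{2n}}$ is over $2n$ i.i.d. observations from $\mathbb P$, and the infimum is over all $\hat\theta$ that are functions of the $2n$ observations.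
   Context: $\nu_d=\mathrm{Unif}([0,1]^d)$; $\mathcal T:=\{f:\ \|f\|_{\infty,[0,1]^d}\le 3\}$ is the set of real functions on $[0,1]^d$ bounded by $3$ in sup norm; $\|\alpha\|_0$ is the number of nonzero entries of $\alpha\in\mathbb R^p$. For function classes $(\mathcal F_\mu,\mathcal F_\pi)$, $\mathcal P(\mathcal F_\mu,\mathcal F_\pi)$ is the family of all distributions $\mathbb P=\mathbb P_{\beta,v,\mu,\pi}$ of $(X,T,Y)$ with $\mu\in\mathcal F_\mu$, $\pi\in\mathcal F_\pi$, $(\beta,v)\in[-3,3]\times[1/3,3]$ such that: - $X\sim\nu_d$; - $T=\pi(X)+u$ with $\mathbb E[u\mid X]=0$, $\mathbb E[u^2\mid X]\equiv v$, and $|T|\le3$; - $Y=\beta T+\mu(X)+\varepsilon$ with $\mathbb E[\varepsilon\mid X,T]=0$ and $|Y|\le3$. The target parameter is $\theta(\mathbb P)=\beta$ for $\mathbb P=\mathbb P_{\beta,v,\mu,\pi}$. *)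

theory Defs
  imports "HOL-Probability.Probability"
begin

abbreviation unit_cube :: "(real ^ 'd::finite) set"
  where "unit_cube \<equiv> cbox 0 1"

text \<open>A function on \<open>[0,1]^d\<close> is represented by a Borel function on \<open>\<real>^d\<close>. Its values
  off the cube are immaterial, since the cube carries the whole mass of \<open>cube_unif\<close>.\<close>

definition cube_unif :: "(real ^ 'd::finite) measure"
  where "cube_unif = uniform_measure lborel unit_cube"

definition bdd_class :: "(real ^ 'd::finite \<Rightarrow> real) set"
  where "bdd_class = {f \<in> borel_measurable borel. \<forall>x\<in>unit_cube. \<bar>f x\<bar> \<le> 3}"

definition L2_dist :: "(real ^ 'd::finite \<Rightarrow> real) \<Rightarrow> (real ^ 'd \<Rightarrow> real) \<Rightarrow> real"
  where "L2_dist f g = sqrt (\<integral>x. (f x - g x)\<^sup>2 \<partial>cube_unif)"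

definition L2_ball :: "(real ^ 'd::finite \<Rightarrow> real) \<Rightarrow> real \<Rightarrow> (real ^ 'd \<Rightarrow> real) set"
  where "L2_ball g \<delta> = {f \<in> bdd_class. L2_dist f g \<le> \<delta>}"

text \<open>The features \<open>\<phi>\<^sub>1, \<dots>, \<phi>\<^sub>p\<close> are \<open>\<phi> j\<close> for \<open>j \<in> {1..p}\<close>; other indices are ignored.\<close>

definition orthonormal_features :: "nat \<Rightarrow> (nat \<Rightarrow> real ^ 'd::finite \<Rightarrow> real) \<Rightarrow> bool"
  where "orthonormal_features p \<phi> \<longleftrightarrow>
    (\<forall>j\<in>{1..p}. \<phi> j \<in> borel_measurable borel) \<and>
    (\<forall>i\<in>{1..p}. \<forall>j\<in>{1..p}.
       has_bochner_integral cube_unif (\<lambda>x. \<phi> i x * \<phi> j x) (if i = j then 1 else 0))"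

definition sparse_class ::
    "(nat \<Rightarrow> real ^ 'd::finite \<Rightarrow> real) \<Rightarrow> nat \<Rightarrow> nat \<Rightarrow> (real ^ 'd \<Rightarrow> real) set"
  where "sparse_class \<phi> p s =
    {g \<in> bdd_class. \<exists>\<alpha> :: nat \<Rightarrow> real.
       g = (\<lambda>x. \<Sum>j=1..p. \<alpha> j * \<phi> j x) \<and> card {j\<in>{1..p}. \<alpha> j \<noteq> 0} \<le> s}"

text \<open>An observation is \<open>(X, T, Y)\<close>.\<close>

type_synonym 'd obs = "(real ^ 'd) \<times> real \<times> real"

definition obs_X :: "'d::finite obs \<Rightarrow> real ^ 'd" where "obs_X z = fst z"
definition obs_T :: "'d::finite obs \<Rightarrow> real" where "obs_T z = fst (snd z)"
definition obs_Y :: "'d::finite obs \<Rightarrow> real" where "obs_Y z = snd (snd z)"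

definition cond_mean ::
    "'a measure \<Rightarrow> ('a \<Rightarrow> 'b::topological_space) \<Rightarrow> ('a \<Rightarrow> real) \<Rightarrow> 'a \<Rightarrow> real"
  where "cond_mean P Z f = real_cond_exp P (vimage_algebra (space P) Z borel) f"

definition plm_dist ::
    "real \<Rightarrow> real \<Rightarrow> (real ^ 'd::finite \<Rightarrow> real) \<Rightarrow> (real ^ 'd \<Rightarrow> real) \<Rightarrow> 'd obs measure \<Rightarrow> bool"
  where "plm_dist \<beta> v \<mu> \<pi> P \<longleftrightarrow>
    prob_space P \<and> sets P = sets borel \<and>
    distr P borel obs_X = cube_unif \<and>
    (AE z in P. cond_mean P obs_X (\<lambda>z. obs_T z - \<pi> (obs_X z)) z = 0) \<and>
    (AE z in P. cond_mean P obs_X (\<lambda>z. (obs_T z - \<pi> (obs_X z))\<^sup>2) z = v) \<and>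
    (AE z in P. \<bar>obs_T z\<bar> \<le> 3) \<and>
    (AE z in P. cond_mean P (\<lambda>z. (obs_X z, obs_T z))
                  (\<lambda>z. obs_Y z - \<beta> * obs_T z - \<mu> (obs_X z)) z = 0) \<and>
    (AE z in P. \<bar>obs_Y z\<bar> \<le> 3)"

definition plm_family ::
    "(real ^ 'd::finite \<Rightarrow> real) set \<Rightarrow> (real ^ 'd \<Rightarrow> real) set \<Rightarrow> 'd obs measure set"
  where "plm_family F\<^sub>\<mu> F\<^sub>\<pi> =
    {P. \<exists>\<beta>\<in>{-3..3}. \<exists>v\<in>{1/3..3}. \<exists>\<mu>\<in>F\<^sub>\<mu>. \<exists>\<pi>\<in>F\<^sub>\<pi>. plm_dist \<beta> v \<mu> \<pi> P}"

text \<open>\<open>\<theta>(P) = \<beta>\<close> for \<open>P = P\<^bsub>\<beta>,v,\<mu>,\<pi>\<^esub>\<close>; \<open>target_eq\<close> below shows that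
  \<open>\<beta>\<close> is determined by \<open>P\<close>.\<close>

definition target :: "'d::finite obs measure \<Rightarrow> real"
  where "target P =
    (THE \<beta>. \<beta> \<in> {-3..3} \<and> (\<exists>v\<in>{1/3..3}. \<exists>\<mu>\<in>bdd_class. \<exists>\<pi>\<in>bdd_class. plm_dist \<beta> v \<mu> \<pi> P))"

text \<open>Estimators are the Borel functions of the \<open>N\<close> i.i.d. observations. The risk is a
  Lebesgue integral in \<open>[0,\<infinity>]\<close>, so it is infinite for an estimator without a mean.\<close>

definition minimax_risk ::
    "nat \<Rightarrow> 'a::topological_space measure set \<Rightarrow> ('a measure \<Rightarrow> real) \<Rightarrow> ennreal"
  where "minimax_risk N \<P> \<theta> =
    (INF est \<in> borel_measurable (\<Pi>\<^sub>M i\<in>{..<N}. (borel :: 'a measure)).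
       SUP P \<in> \<P>. \<integral>\<^sup>+ z. ennreal \<bar>est z - \<theta> P\<bar> \<partial>(\<Pi>\<^sub>M i\<in>{..<N}. P))"

lemma obs_measurable [measurable]:
  shows "obs_X \<in> borel_measurable borel" and "obs_T \<in> borel_measurable borel"
    and "obs_Y \<in> borel_measurable borel"
  unfolding obs_X_def[abs_def] obs_T_def[abs_def] obs_Y_def[abs_def]
  by (intro borel_measurable_continuous_onI continuous_intros)+

lemma plm_dist_unique:
  fixes \<mu> \<pi> \<mu>' \<pi>' :: "real ^ 'd::finite \<Rightarrow> real"
  assumes P: "plm_dist \<beta> v \<mu> \<pi> P" and P': "plm_dist \<beta>' v' \<mu>' \<pi>' P"
    and F: "\<mu> \<in> bdd_class" "\<pi> \<in> bdd_class" "\<mu>' \<in> bdd_class" and v: "v > 0"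
  shows "\<beta> = \<beta>'"
proof (rule ccontr)
  assume ne: "\<beta> \<noteq> \<beta>'"
  interpret prob_space P using P by (simp add: plm_dist_def)
  have sP[measurable_cong]: "sets P = sets borel" using P by (simp add: plm_dist_def)
  have spP: "space P = UNIV" using sets_eq_imp_space_eq[OF sP] by simp
  have [measurable]: "\<mu> \<in> borel_measurable borel" "\<pi> \<in> borel_measurable borel"
    "\<mu>' \<in> borel_measurable borel" using F by (auto simp: bdd_class_def)
  define FX where "FX = vimage_algebra (space P) (obs_X :: 'd obs \<Rightarrow> _) borel"
  define FG where "FG = vimage_algebra (space P) (\<lambda>z :: 'd obs. (obs_X z, obs_T z)) borel"
  have XT[measurable]: "(\<lambda>z :: 'd obs. (obs_X z, obs_T z)) \<in> borel_measurable P"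
    by (simp add: borel_prod[symmetric])
  have sub: "subalgebra P FX" "subalgebra P FG"
    unfolding subalgebra_def FX_def FG_def
    by (auto simp: sets_vimage_algebra2 intro!: measurable_sets[OF XT])
  interpret X: finite_measure_subalgebra P FX by standard (rule sub)
  interpret G: finite_measure_subalgebra P FG by standard (rule sub)
  have mX: "(obs_X :: 'd obs \<Rightarrow> _) \<in> FX \<rightarrow>\<^sub>M borel"
    unfolding FX_def by (rule measurable_vimage_algebra1) auto
  have mG: "(\<lambda>z :: 'd obs. (obs_X z, obs_T z)) \<in> FG \<rightarrow>\<^sub>M borel"
    unfolding FG_def by (rule measurable_vimage_algebra1) auto
  have mG2: "(\<lambda>z :: 'd obs. (obs_X z, obs_T z)) \<in> FG \<rightarrow>\<^sub>M borel \<Otimes>\<^sub>M borel"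
    using mG by (simp add: borel_prod)
  have GX: "(obs_X :: 'd obs \<Rightarrow> _) \<in> FG \<rightarrow>\<^sub>M borel" and GT: "(obs_T :: 'd obs \<Rightarrow> _) \<in> FG \<rightarrow>\<^sub>M borel"
    using measurable_compose[OF mG2 measurable_fst] measurable_compose[OF mG2 measurable_snd]
    by simp_all
  have cube: "AE z in P. obs_X z \<in> unit_cube"
  proof -
    have one: "(1 :: real^'d) \<bullet> b = 1" if "b \<in> Basis" for b
      using that by (auto simp: Basis_vec_def inner_axis)
    have "emeasure lborel (unit_cube :: (real^'d) set) \<noteq> 0"
      by (simp add: emeasure_lborel_cbox_eq one)
    moreover have "emeasure lborel (unit_cube :: (real^'d) set) \<noteq> \<infinity>"
      using emeasure_lborel_cbox_finite[of "0::real^'d" 1] by simp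
    ultimately have "AE x in (cube_unif :: (real^'d) measure). x \<in> unit_cube"
      unfolding cube_unif_def by (intro AE_uniform_measureI) auto
    moreover have d: "distr P borel obs_X = cube_unif" using P by (simp add: plm_dist_def)
    ultimately have "AE x in distr P borel obs_X. x \<in> (unit_cube :: (real^'d) set)"
      by (subst d)
    then show ?thesis by (subst (asm) AE_distr_iff) auto
  qed
  have Tb: "AE z in P. \<bar>obs_T z\<bar> \<le> 3" and Yb: "AE z in P. \<bar>obs_Y z\<bar> \<le> 3"
    using P by (auto simp: plm_dist_def)
  have iT: "integrable P obs_T" and iY: "integrable P obs_Y"
    using Tb Yb by (auto intro!: integrable_const_bound[where B = 3])
  have iX: "integrable P (\<lambda>z. f (obs_X z))" if "f \<in> bdd_class" for f :: "real^'d \<Rightarrow> real"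
  proof -
    have [measurable]: "f \<in> borel_measurable borel" using that by (simp add: bdd_class_def)
    show ?thesis
      by (rule integrable_const_bound[where B = 3])
        (use cube that in \<open>auto simp: bdd_class_def elim!: eventually_mono\<close>)
  qed
  have Yc: "AE z in P. real_cond_exp P FG obs_Y z = b * obs_T z + m (obs_X z)"
    if m: "m \<in> bdd_class" and Q: "plm_dist b w m q P" for b w q and m :: "real^'d \<Rightarrow> real"
  proof -
    have [measurable]: "m \<in> borel_measurable borel" using m by (simp add: bdd_class_def)
    let ?r = "\<lambda>z. b * obs_T z + m (obs_X z)"
    have ir: "integrable P ?r" using iT iX[OF m] by auto
    have "?r \<in> borel_measurable FG"
      using GT measurable_compose[OF GX \<open>m \<in> borel_measurable borel\<close>] by measurable
    from G.real_cond_exp_F_meas[OF ir this] G.real_cond_exp_diff[OF iY ir]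
    have "AE z in P. real_cond_exp P FG (\<lambda>z. obs_Y z - ?r z) z = real_cond_exp P FG obs_Y z - ?r z"
      by eventually_elim simp
    moreover have "AE z in P. real_cond_exp P FG (\<lambda>z. obs_Y z - ?r z) z = 0"
      using Q by (simp add: plm_dist_def cond_mean_def FG_def algebra_simps)
    ultimately show ?thesis by eventually_elim simp
  qed
  define h where "h x = (\<mu>' x - \<mu> x) / (\<beta> - \<beta>')" for x
  have [measurable]: "h \<in> borel_measurable borel" unfolding h_def[abs_def] by measurable
  have Th: "AE z in P. obs_T z = h (obs_X z)"
    using Yc[OF F(1) P] Yc[OF F(3) P']
    by eventually_elim (use ne in \<open>simp add: h_def field_simps\<close>)
  have ih: "integrable P (\<lambda>z. h (obs_X z))"
    using iX[OF F(1)] iX[OF F(3)] by (simp add: h_def)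
  have mFX: "(\<lambda>z. h (obs_X z) - \<pi> (obs_X z)) \<in> borel_measurable FX"
    by (rule measurable_compose[OF mX]) measurable
  have "AE z in P. real_cond_exp P FX (\<lambda>z. h (obs_X z) - \<pi> (obs_X z)) z = h (obs_X z) - \<pi> (obs_X z)"
    by (rule X.real_cond_exp_F_meas[OF _ mFX]) (use ih iX[OF F(2)] in auto)
  moreover have "AE z in P. real_cond_exp P FX (\<lambda>z. obs_T z - \<pi> (obs_X z)) z
      = real_cond_exp P FX (\<lambda>z. h (obs_X z) - \<pi> (obs_X z)) z"
    by (rule X.real_cond_exp_cong) (use Th in auto)
  moreover have "AE z in P. real_cond_exp P FX (\<lambda>z. obs_T z - \<pi> (obs_X z)) z = 0"
    using P by (simp add: plm_dist_def cond_mean_def FX_def)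
  ultimately have u0: "AE z in P. (obs_T z - \<pi> (obs_X z))\<^sup>2 = 0"
    using Th by eventually_elim simp
  have "AE z in P. real_cond_exp P FX (\<lambda>z. (obs_T z - \<pi> (obs_X z))\<^sup>2) z = real_cond_exp P FX (\<lambda>z. 0) z"
    by (rule X.real_cond_exp_cong) (use u0 in auto)
  moreover have "AE z in P. real_cond_exp P FX (\<lambda>z. 0) z = 0"
    by (rule X.real_cond_exp_F_meas) auto
  moreover have "AE z in P. real_cond_exp P FX (\<lambda>z. (obs_T z - \<pi> (obs_X z))\<^sup>2) z = v"
    using P by (simp add: plm_dist_def cond_mean_def FX_def)
  ultimately have "AE z in P. False" by eventually_elim (use v in simp)
  then show False by simp
qed

lemma target_eq:
  assumes "plm_dist \<beta> v \<mu> \<pi> P" "\<beta> \<in> {-3..3}" "v \<in> {1/3..3}" "\<mu> \<in> bdd_class" "\<pi> \<in> bdd_class"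
  shows "target P = \<beta>"
  unfolding target_def
proof (rule the_equality)
  show "\<beta> \<in> {-3..3} \<and> (\<exists>v\<in>{1/3..3}. \<exists>\<mu>\<in>bdd_class. \<exists>\<pi>\<in>bdd_class. plm_dist \<beta> v \<mu> \<pi> P)"
    using assms by blast
next
  fix b assume "b \<in> {-3..3} \<and> (\<exists>v\<in>{1/3..3}. \<exists>\<mu>\<in>bdd_class. \<exists>\<pi>\<in>bdd_class. plm_dist b v \<mu> \<pi> P)"
  then obtain w m q where "plm_dist b w m q P" "w > 0" "m \<in> bdd_class" "q \<in> bdd_class"
    by force
  then show "b = \<beta>" using plm_dist_unique assms(1,4) by blast
qed

end

(* Take T and Y with values in {-1, 1}, E[T | X] = a h(X) and E[Y | X, T] = beta T + b h(X) for a
   function h with values in {-1, 1}. Relative to the law with X, T, Y independent and uniform this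
   has density 1 + h (a T + (b + a beta) Y) + (beta + a b) T Y. For beta = -a b the last term
   vanishes, so randomising h hides a parameter of size |a b|: the second moment of the mixture of
   likelihood ratios depends only on the correlation of two independent copies of h. With random
   signs on a fine partition this gives the product of the two radii. For the sparse term, the
   features split the cube into s cells carrying Rademacher functions, and h selects one function
   in each cell at random; it is s-sparse and yet bounded by 1. The parametric rate is the case
   a = b = 0. *)

theory Submission
  imports Defs
begin

text \<open>With N observations, two alternatives with patterns h and h' have likelihood inner
  product (1 + q E[h h'])^N, where q is at most a^2 + b^2. The average over independent h and h' has
  to stay below 2. Choosing one of M Rademacher functions in each of s cells makes E[h h'] the
  fraction of cells where two choices agree, so the average splits over the cells, and s exp (N q /
  s) <= M / 2 is enough. One scheme thus serves both nuisance bounds. For the L2 balls it is used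
  with s = 1: the balls contain scaled sign patterns of any fineness, so M can be taken as large as
  N requires. Sparsity limits M to about p / s, which still allows a^2 and b^2 of order s log p / n;
  n <= p^(1/3) ensures that p / s is large compared with s. The constants are 1/8, 1/4 and 1/48. The
  largest of the three bounds is at least the sum of the three terms divided by 8 + 4 + 48 = 60,
  which leaves room for 1/211.\<close>

section \<open>The uniform law on the cube and finite labels\<close>

lemma sets_cube_unif [simp, measurable_cong]: "sets (cube_unif :: (real ^ 'd::finite) measure) = sets borel"
  by (simp add: cube_unif_def)

lemma space_cube_unif [simp]: "space (cube_unif :: (real ^ 'd::finite) measure) = UNIV"
  by (simp add: cube_unif_def)

lemma emeasure_unit_cube: "emeasure lborel (unit_cube :: (real ^ 'd::finite) set) = 1"
proof -
  have one: "(1 :: real^'d) \<bullet> b = 1" if "b \<in> Basis" for b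
    using that by (auto simp: Basis_vec_def inner_axis)
  show ?thesis by (simp add: emeasure_lborel_cbox_eq one)
qed

lemma prob_space_cube_unif: "prob_space (cube_unif :: (real ^ 'd::finite) measure)"
  unfolding cube_unif_def by (rule prob_space_uniform_measure) (simp_all add: emeasure_unit_cube)

lemma measure_cube_unif_slab:
  fixes k :: "'d::finite"
  assumes "0 \<le> a" "a \<le> b" "b \<le> 1"
  shows "measure (cube_unif :: (real ^ 'd) measure) {x. a \<le> x $ k \<and> x $ k \<le> b} = b - a"
proof -
  let ?l = "(\<chi> j. if j = k then a else 0) :: real ^ 'd" and ?u = "(\<chi> j. if j = k then b else 1) :: real ^ 'd"
  have S: "{x :: real ^ 'd. a \<le> x $ k \<and> x $ k \<le> b} \<in> sets borel"
    by (intro borel_closed closed_Collect_conj closed_Collect_le continuous_intros)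
  have "unit_cube \<inter> {x :: real ^ 'd. a \<le> x $ k \<and> x $ k \<le> b} = cbox ?l ?u"
  proof (intro set_eqI)
    fix x :: "real ^ 'd"
    have "(\<forall>j. 0 \<le> x $ j \<and> x $ j \<le> 1) \<and> a \<le> x $ k \<and> x $ k \<le> b
      \<longleftrightarrow> (\<forall>j. (if j = k then a else 0) \<le> x $ j \<and> x $ j \<le> (if j = k then b else 1))"
      using assms by (smt (verit))
    then show "x \<in> unit_cube \<inter> {x. a \<le> x $ k \<and> x $ k \<le> b} \<longleftrightarrow> x \<in> cbox ?l ?u"
      by (simp add: mem_box_cart)
  qed
  then have "measure (cube_unif :: (real ^ 'd) measure) {x. a \<le> x $ k \<and> x $ k \<le> b}
      = measure lborel (cbox ?l ?u)"
    using S by (simp add: cube_unif_def measure_uniform_measure emeasure_unit_cube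
        measure_def[of lborel unit_cube])
  also have "\<dots> = (\<Prod>j\<in>UNIV. ?u $ j - ?l $ j)"
    using assms by (subst content_cbox_cart) (auto simp: interval_ne_empty_cart)
  also have "\<dots> = (\<Prod>j\<in>UNIV. if j = k then b - a else 1)" by (rule prod.cong) auto
  finally show ?thesis by simp
qed

text \<open>Cutting one coordinate into \<open>card E\<close> slabs lets a point of the cube carry a
  uniform label, so that features and patterns can be built combinatorially on \<open>E\<close>. Up
  to a null set each slab lies in a closed one of mass \<open>1 / L\<close>; the masses add up to 1,
  so none is smaller, and shared boundaries need no bookkeeping.\<close>

lemma uniform_cube_label:
  fixes E :: "'e set"
  assumes E: "finite E" "E \<noteq> {}"
  obtains N :: "real ^ 'd::finite \<Rightarrow> 'e"
  where "\<And>x. N x \<in> E" "\<And>g :: 'e \<Rightarrow> real. (\<lambda>x. g (N x)) \<in> borel_measurable borel"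
    "\<And>g :: 'e \<Rightarrow> real. has_bochner_integral cube_unif (\<lambda>x. g (N x)) ((\<Sum>e\<in>E. g e) / real (card E))"
proof -
  define L where "L = card E"
  have L: "L > 0" using E by (simp add: L_def card_gt_0_iff)
  obtain e where e: "bij_betw e {0..<L} E" using ex_bij_betw_nat_finite[OF E(1)] L_def by blast
  obtain k :: 'd where True by simp
  \<comment> \<open>\<open>min (L - 1)\<close> puts the face \<open>x $ k = 1\<close> into the last
    slab and, together with \<open>nat\<close>, keeps the index below \<open>L\<close> off the cube
    too.\<close>
  define I :: "real ^ 'd \<Rightarrow> nat" where "I x = min (L - 1) (nat \<lfloor>real L * x $ k\<rfloor>)" for x
  have IL: "I x < L" for x using L by (simp add: I_def min_def) auto
  have k: "(\<lambda>x :: real ^ 'd. x $ k) \<in> borel_measurable borel"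
    by (intro borel_measurable_continuous_onI continuous_intros)
  have I[measurable]: "I \<in> borel \<rightarrow>\<^sub>M count_space UNIV"
    unfolding I_def[abs_def] using k by measurable
  interpret prob_space "cube_unif :: (real ^ 'd) measure" by (rule prob_space_cube_unif)
  define D where "D l = {x. I x = l}" for l
  have D: "D l \<in> sets borel" for l
    using measurable_sets[OF I, of "{l}"] by (simp add: D_def vimage_def)
  have cube: "AE x in (cube_unif :: (real ^ 'd) measure). x \<in> unit_cube"
    unfolding cube_unif_def by (intro AE_uniform_measureI) auto
  have le: "prob (D l) \<le> 1 / L" if l: "l < L" for l
  proof -
    have "prob (D l) \<le> prob {x. l / L \<le> x $ k \<and> x $ k \<le> (l + 1) / L}"
    proof (rule finite_measure_mono_AE)
      show "AE x in cube_unif. x \<in> D l \<longrightarrow> x \<in> {x. l / L \<le> x $ k \<and> x $ k \<le> (l + 1) / L}"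
        using cube
      proof eventually_elim
        case (elim x)
        then have x: "0 \<le> x $ k" "x $ k \<le> 1" by (auto simp: mem_box_cart)
        then have "0 \<le> real L * x $ k" "real L * x $ k \<le> L" using L by (auto simp: mult_left_le)
        moreover have "real (nat \<lfloor>real L * x $ k\<rfloor>) \<le> real L * x $ k"
          "real L * x $ k < real (nat \<lfloor>real L * x $ k\<rfloor>) + 1"
          using calculation(1) by linarith+
        ultimately have "real l \<le> real L * x $ k \<and> real L * x $ k \<le> real l + 1" if "I x = l"
          using that L by (auto simp: I_def min_def of_nat_diff split: if_splits) 
        then show ?case using L by (auto simp: D_def field_simps)
      qed
    next
      show "{x :: real ^ 'd. l / L \<le> x $ k \<and> x $ k \<le> (l + 1) / L} \<in> events"
        unfolding sets_cube_unif
        by (intro borel_closed closed_Collect_conj closed_Collect_le continuous_intros)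
    qed
    also have "\<dots> = (l + 1) / L - l / L"
      using l by (intro measure_cube_unif_slab) (auto simp: field_simps)
    also have "\<dots> = 1 / L" by (simp add: add_divide_distrib)
    finally show ?thesis .
  qed
  have "(\<Sum>l<L. prob (D l)) = prob (\<Union>l<L. D l)"
    by (rule finite_measure_finite_Union[symmetric])
      (use D in \<open>auto simp: disjoint_family_on_def D_def\<close>)
  also have "(\<Union>l<L. D l) = UNIV" using IL by (auto simp: D_def)
  finally have sum1: "(\<Sum>l<L. prob (D l)) = 1" using prob_space by simp
  have eq: "prob (D l) = 1 / L" if l: "l < L" for l
  proof (rule ccontr)
    assume "prob (D l) \<noteq> 1 / L"
    then have "prob (D l) < 1 / L" using le[OF l] by simp
    then have "(\<Sum>l<L. prob (D l)) < (\<Sum>l<L. 1 / L)"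
      using le l by (intro sum_strict_mono_ex1) auto
    then show False using sum1 L by simp
  qed
  show thesis
  proof (rule that[of "\<lambda>x. e (I x)"])
    show "e (I x) \<in> E" for x using e IL by (auto simp: bij_betw_def)
    show "(\<lambda>x. g (e (I x))) \<in> borel_measurable borel" for g :: "'e \<Rightarrow> real"
      by measurable
    show "has_bochner_integral cube_unif (\<lambda>x. g (e (I x))) ((\<Sum>e\<in>E. g e) / real (card E))"
      for g :: "'e \<Rightarrow> real"
    proof -
      have "has_bochner_integral cube_unif (\<lambda>x. \<Sum>l<L. g (e l) * indicator (D l) x)
          (\<Sum>l<L. g (e l) * prob (D l))"
        using D by (intro has_bochner_integral_sum has_bochner_integral_mult_right
            has_bochner_integral_real_indicator) (auto simp: emeasure_eq_measure)
      also have "(\<lambda>x. \<Sum>l<L. g (e l) * indicator (D l) x) = (\<lambda>x. g (e (I x)))"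
        using IL by (auto simp: D_def indicator_def if_distrib sum.delta cong: if_cong)
      also have "(\<Sum>l<L. g (e l) * prob (D l)) = (\<Sum>l<L. g (e l)) / L"
        by (simp add: eq sum_divide_distrib)
      also have "(\<Sum>l<L. g (e l)) = (\<Sum>e\<in>E. g e)"
        using sum.reindex_bij_betw[OF e, of g] by (simp add: atLeast0LessThan)
      finally show ?thesis by (simp add: L_def)
    qed
  qed
qed

section \<open>Likelihood ratios and the two-point method\<close>

text \<open>This gives the joint law of the sample under an alternative a likelihood ratio relative
  to the null sample, namely the product of the individual ratios. A product measure is determined
  by boxes, and there the integral factorises.\<close>

lemma PiM_density:
  fixes f :: "'a \<Rightarrow> real"
  assumes Q: "prob_space Q" and I: "finite I"
    and f: "f \<in> borel_measurable Q" "\<And>z. f z \<ge> 0" and D: "prob_space (density Q f)"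
  shows "(\<Pi>\<^sub>M i\<in>I. density Q f) = density (\<Pi>\<^sub>M i\<in>I. Q) (\<lambda>z. \<Prod>i\<in>I. f (z i))"
proof -
  interpret Q: prob_space Q by fact
  interpret D: prob_space "density Q f" by fact
  interpret Q: product_sigma_finite "\<lambda>_. Q" by standard
  interpret D: product_sigma_finite "\<lambda>_. density Q f" by standard
  note f(1)[measurable]
  show ?thesis
  proof (rule D.PiM_eqI[OF I, symmetric])
    show "sets (density (\<Pi>\<^sub>M i\<in>I. Q) (\<lambda>z. \<Prod>i\<in>I. f (z i))) = sets (\<Pi>\<^sub>M i\<in>I. density Q f)"
      by (simp cong: sets_PiM_cong)
  next
    fix A assume A: "A i \<in> sets (density Q f)" if "i \<in> I" for i
    then have [measurable]: "A i \<in> sets Q" if "i \<in> I" for i using that by simp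
    have "emeasure (density (\<Pi>\<^sub>M i\<in>I. Q) (\<lambda>z. \<Prod>i\<in>I. f (z i))) (Pi\<^sub>E I A)
        = (\<integral>\<^sup>+z. ennreal (\<Prod>i\<in>I. f (z i)) * indicator (Pi\<^sub>E I A) z \<partial>(\<Pi>\<^sub>M i\<in>I. Q))"
      using I A by (subst emeasure_density) (auto intro!: sets_PiM_I_finite)
    also have "\<dots> = (\<integral>\<^sup>+z. (\<Prod>i\<in>I. ennreal (f (z i)) * indicator (A i) (z i)) \<partial>(\<Pi>\<^sub>M i\<in>I. Q))"
    proof (rule nn_integral_cong)
      fix z assume "z \<in> space (\<Pi>\<^sub>M i\<in>I. Q)"
      then have "z \<in> Pi\<^sub>E I A \<longleftrightarrow> (\<forall>i\<in>I. z i \<in> A i)"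
        by (auto simp: space_PiM PiE_iff)
      then have "indicator (Pi\<^sub>E I A) z = (\<Prod>i\<in>I. indicator (A i) (z i) :: ennreal)"
        using I by (auto simp: indicator_def)
      then show "ennreal (\<Prod>i\<in>I. f (z i)) * indicator (Pi\<^sub>E I A) z
          = (\<Prod>i\<in>I. ennreal (f (z i)) * indicator (A i) (z i))"
        by (simp add: prod.distrib prod_ennreal f(2))
    qed
    also have "\<dots> = (\<Prod>i\<in>I. \<integral>\<^sup>+z. ennreal (f z) * indicator (A i) z \<partial>Q)"
      by (rule Q.product_nn_integral_prod[OF I]) measurable
    also have "\<dots> = (\<Prod>i\<in>I. emeasure (density Q f) (A i))"
      using A by (intro prod.cong refl) (simp add: emeasure_density)
    finally show "emeasure (density (\<Pi>\<^sub>M i\<in>I. Q) (\<lambda>z. \<Prod>i\<in>I. f (z i))) (Pi\<^sub>E I A)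
        = (\<Prod>i\<in>I. emeasure (density Q f) (A i))" .
  qed
qed

text \<open>The parabola equals \<open>1 - (x / 2 - 1)\<^sup>2\<close>: it touches level 1 at x = 2,
  and 1/4 is the smallest coefficient that keeps it below this level.\<close>

lemma min_one_ge: "min 1 x \<ge> x - x\<^sup>2 / 4" for x :: real
proof -
  have "(x / 2 - 1)\<^sup>2 \<ge> 0" "x\<^sup>2 \<ge> 0" by simp_all
  then show ?thesis by (simp add: power2_eq_square min_def algebra_simps)
qed

text \<open>Le Cam's two-point method with a mixture as second point. With \<open>F\<close> the density of the
  mixture, the two risks add up to at least \<open>\<bar>\<theta>\<^sub>1 - \<theta>\<^sub>0\<bar> E[min(1, F)]\<close>, and
  \<open>min(1, F) \<ge> F - F\<^sup>2 / 4\<close> turns a bound on the second moment of \<open>F\<close> into one on the risk.\<close>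

lemma minimax_risk_mixture:
  fixes f :: "'w \<Rightarrow> 'a::topological_space \<Rightarrow> real"
  assumes Q: "prob_space Q" "sets Q = sets borel" "Q \<in> \<P>" "\<theta> Q = \<theta>\<^sub>0"
    and W: "finite W" "W \<noteq> {}"
    and f: "\<And>w. w \<in> W \<Longrightarrow> f w \<in> borel_measurable Q" "\<And>w z. w \<in> W \<Longrightarrow> f w z \<ge> 0"
      "\<And>w z. w \<in> W \<Longrightarrow> f w z \<le> B"
    and D: "\<And>w. w \<in> W \<Longrightarrow> prob_space (density Q (f w))" "\<And>w. w \<in> W \<Longrightarrow> density Q (f w) \<in> \<P>"
      "\<And>w. w \<in> W \<Longrightarrow> \<theta> (density Q (f w)) = \<theta>\<^sub>1"
    and moment: "(\<Sum>w\<in>W. \<Sum>w'\<in>W. (\<integral>z. f w z * f w' z \<partial>Q) ^ N) \<le> 2 * (real (card W))\<^sup>2"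
  shows "minimax_risk N \<P> \<theta> \<ge> ennreal (\<bar>\<theta>\<^sub>1 - \<theta>\<^sub>0\<bar> / 4)"
  unfolding minimax_risk_def
proof (rule INF_greatest)
  fix est :: "(nat \<Rightarrow> 'a) \<Rightarrow> real"
  assume "est \<in> borel_measurable (\<Pi>\<^sub>M i\<in>{..<N}. (borel :: 'a measure))"
  define PN where "PN = (\<Pi>\<^sub>M i\<in>{..<N}. Q)"
  have "sets PN = sets (\<Pi>\<^sub>M i\<in>{..<N}. (borel :: 'a measure))"
    unfolding PN_def by (rule sets_PiM_cong) (simp_all add: Q)
  then have est[measurable]: "est \<in> borel_measurable PN"
    using \<open>est \<in> _\<close> by (simp cong: measurable_cong_sets)
  interpret Q: prob_space Q by fact
  interpret QN: product_prob_space "\<lambda>_. Q" "{..<N}" by standard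
  interpret PN: prob_space PN unfolding PN_def by (rule QN.prob_space_axioms)
  interpret ps: product_sigma_finite "\<lambda>_. Q" by standard
  define R where "R = (SUP P \<in> \<P>. \<integral>\<^sup>+ z. ennreal \<bar>est z - \<theta> P\<bar> \<partial>(\<Pi>\<^sub>M i\<in>{..<N}. P))"
  define L where "L w z = (\<Prod>i<N. f w (z i))" for w and z :: "nat \<Rightarrow> 'a"
  define F where "F z = (\<Sum>w\<in>W. L w z) / card W" for z
  have c: "real (card W) > 0" using W by (simp add: card_gt_0_iff)
  have L0: "L w z \<ge> 0" if "w \<in> W" for w z unfolding L_def by (intro prod_nonneg) (use f that in auto)
  have F0: "F z \<ge> 0" for z unfolding F_def using L0 c by (intro divide_nonneg_nonneg sum_nonneg) auto
  have Lm[measurable]: "L w \<in> borel_measurable PN" if "w \<in> W" for w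
    unfolding L_def[abs_def] PN_def using f(1)[OF that] by measurable
  have Fm[measurable]: "F \<in> borel_measurable PN"
    unfolding F_def[abs_def] by measurable
  have fi: "integrable Q (f w)" if "w \<in> W" for w
    using f that by (intro Q.integrable_const_bound[where B = B]) auto
  have B: "B \<ge> 0" using W f(2,3) by (meson all_not_in_conv order.trans)
  have ffi: "integrable Q (\<lambda>z. f w z * f w' z)" if "w \<in> W" "w' \<in> W" for w w'
    by (intro Q.integrable_const_bound[where B = "B * B"])
      (use f that B in \<open>auto simp: abs_mult intro!: mult_mono\<close>)
  have f1: "(\<integral>z. f w z \<partial>Q) = 1" if w: "w \<in> W" for w
  proof -
    interpret D: prob_space "density Q (f w)" by (rule D) fact
    have "(\<integral>z. f w z * 1 \<partial>Q) = (\<integral>z. 1 \<partial>density Q (f w))"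
      using f w by (intro integral_real_density[symmetric]) auto
    then show ?thesis using D.prob_space by simp
  qed
  have L1: "has_bochner_integral PN (L w) 1" if "w \<in> W" for w
    unfolding L_def[abs_def] PN_def has_bochner_integral_iff
    using ps.product_integrable_prod[of "{..<N}" "\<lambda>_. f w"] ps.product_integral_prod[of "{..<N}" "\<lambda>_. f w"]
      fi[OF that] f1[OF that] by simp
  \<comment> \<open>Independent coordinates turn the inner product of two sample likelihood ratios
    into an \<open>N\<close>-th power, so \<open>moment\<close> is a bound on the second moment of
    \<open>F\<close>.\<close>
  have L2: "has_bochner_integral PN (\<lambda>z. L w z * L w' z) ((\<integral>z. f w z * f w' z \<partial>Q) ^ N)"
    if "w \<in> W" "w' \<in> W" for w w'
    unfolding L_def[abs_def] PN_def has_bochner_integral_iff prod.distrib[symmetric]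
    using ps.product_integrable_prod[of "{..<N}" "\<lambda>_ z. f w z * f w' z"]
      ps.product_integral_prod[of "{..<N}" "\<lambda>_ z. f w z * f w' z"] ffi[OF that] by simp
  have "has_bochner_integral PN F ((\<Sum>w\<in>W. 1) / card W)"
    unfolding F_def[abs_def] by (intro has_bochner_integral_divide_zero has_bochner_integral_sum L1)
  then have F1: "has_bochner_integral PN F 1" using c by simp
  define m2 where "m2 = (\<Sum>w\<in>W. \<Sum>w'\<in>W. (\<integral>z. f w z * f w' z \<partial>Q) ^ N) / (real (card W))\<^sup>2"
  have m2: "m2 \<le> 2" using moment c by (simp add: m2_def field_simps)
  have "has_bochner_integral PN (\<lambda>z. (\<Sum>w\<in>W. \<Sum>w'\<in>W. L w z * L w' z) / (real (card W))\<^sup>2) m2"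
    unfolding m2_def by (intro has_bochner_integral_divide_zero has_bochner_integral_sum L2)
  also have "(\<lambda>z. (\<Sum>w\<in>W. \<Sum>w'\<in>W. L w z * L w' z) / (real (card W))\<^sup>2) = (\<lambda>z. (F z)\<^sup>2)"
    by (simp add: F_def power2_eq_square sum_product)
  finally have F2: "has_bochner_integral PN (\<lambda>z. (F z)\<^sup>2) m2" .
  have minI: "integrable PN (\<lambda>z. min 1 (F z))"
    using F0 by (intro PN.integrable_const_bound[where B = 1]) auto
  have "(\<integral>z. F z - (F z)\<^sup>2 / 4 \<partial>PN) \<le> (\<integral>z. min 1 (F z) \<partial>PN)"
    using F1 F2 minI by (intro integral_mono) (simp_all add: has_bochner_integral_iff min_one_ge del: min.bounded_iff)
  also have "(\<integral>z. F z - (F z)\<^sup>2 / 4 \<partial>PN) = 1 - m2 / 4"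
    using F1 F2 by (simp add: has_bochner_integral_iff)
  finally have half: "(\<integral>z. min 1 (F z) \<partial>PN) \<ge> 1 / 2" using m2 by simp
  let ?d = "\<bar>\<theta>\<^sub>1 - \<theta>\<^sub>0\<bar>"
  have r0: "(\<integral>\<^sup>+z. ennreal \<bar>est z - \<theta>\<^sub>0\<bar> \<partial>PN) \<le> R"
    unfolding R_def PN_def by (rule SUP_upper2[OF Q(3)]) (simp add: Q(4))
  have rw: "(\<integral>\<^sup>+z. ennreal (L w z * \<bar>est z - \<theta>\<^sub>1\<bar>) \<partial>PN) \<le> R" if w: "w \<in> W" for w
  proof -
    have "(\<integral>\<^sup>+z. ennreal (L w z * \<bar>est z - \<theta>\<^sub>1\<bar>) \<partial>PN)
        = (\<integral>\<^sup>+z. ennreal \<bar>est z - \<theta>\<^sub>1\<bar> \<partial>density PN (L w))"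
      using w L0 by (subst nn_integral_density) (auto simp: ennreal_mult' ac_simps)
    also have "density PN (L w) = (\<Pi>\<^sub>M i\<in>{..<N}. density Q (f w))"
      unfolding L_def[abs_def] PN_def using w f D Q by (intro PiM_density[symmetric]) auto
    finally show ?thesis
      unfolding R_def using D(2)[OF w] D(3)[OF w] by (auto intro!: SUP_upper2)
  qed
  \<comment> \<open>All alternatives share the parameter \<open>\<theta>\<^sub>1\<close>; hence the
    risk under the mixture is the average of their risks.\<close>
  have "(\<integral>\<^sup>+z. ennreal (F z * \<bar>est z - \<theta>\<^sub>1\<bar>) \<partial>PN)
      = (\<integral>\<^sup>+z. ennreal (1 / card W) * (\<Sum>w\<in>W. ennreal (L w z * \<bar>est z - \<theta>\<^sub>1\<bar>)) \<partial>PN)"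
    using L0 by (intro nn_integral_cong)
      (simp add: F_def sum_ennreal ennreal_mult'[symmetric] sum_distrib_right[symmetric])
  also have "\<dots> = ennreal (1 / card W) * (\<Sum>w\<in>W. \<integral>\<^sup>+z. ennreal (L w z * \<bar>est z - \<theta>\<^sub>1\<bar>) \<partial>PN)"
    by (simp add: nn_integral_cmult nn_integral_sum)
  also have "\<dots> \<le> ennreal (1 / card W) * (\<Sum>w\<in>W. R)"
    by (intro mult_left_mono sum_mono rw) auto
  also have "\<dots> = R"
    using c by (simp add: ennreal_of_nat_eq_real_of_nat mult.assoc[symmetric] ennreal_mult'[symmetric])
  finally have r1: "(\<integral>\<^sup>+z. ennreal (F z * \<bar>est z - \<theta>\<^sub>1\<bar>) \<partial>PN) \<le> R" .
  have "ennreal (?d / 2) \<le> ennreal (?d * (\<integral>z. min 1 (F z) \<partial>PN))"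
    using half mult_left_mono[OF half, of ?d] by (intro ennreal_leI) simp
  also have "\<dots> = (\<integral>\<^sup>+z. ennreal (?d * min 1 (F z)) \<partial>PN)"
    using minI F0 by (subst nn_integral_eq_integral) auto
  also have "\<dots> \<le> (\<integral>\<^sup>+z. ennreal \<bar>est z - \<theta>\<^sub>0\<bar> + ennreal (F z * \<bar>est z - \<theta>\<^sub>1\<bar>) \<partial>PN)"
  proof (rule nn_integral_mono)
    fix z
    \<comment> \<open>Triangle inequality for the two parameters, weighted by
      \<open>min 1 (F z)\<close>, which is at most the density of either hypothesis.\<close>
    have "?d * min 1 (F z) \<le> (\<bar>est z - \<theta>\<^sub>0\<bar> + \<bar>est z - \<theta>\<^sub>1\<bar>) * min 1 (F z)"
      using F0[of z] by (intro mult_right_mono) auto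
    also have "\<dots> \<le> \<bar>est z - \<theta>\<^sub>0\<bar> * 1 + \<bar>est z - \<theta>\<^sub>1\<bar> * F z"
      unfolding distrib_right by (intro add_mono mult_left_mono) auto
    finally show "ennreal (?d * min 1 (F z)) \<le> ennreal \<bar>est z - \<theta>\<^sub>0\<bar> + ennreal (F z * \<bar>est z - \<theta>\<^sub>1\<bar>)"
      using F0[of z] by (simp add: mult.commute del: ennreal_plus flip: ennreal_plus)
  qed
  also have "\<dots> = (\<integral>\<^sup>+z. ennreal \<bar>est z - \<theta>\<^sub>0\<bar> \<partial>PN) + (\<integral>\<^sup>+z. ennreal (F z * \<bar>est z - \<theta>\<^sub>1\<bar>) \<partial>PN)"
    by (rule nn_integral_add) measurable
  also have "\<dots> \<le> R + R" by (intro add_mono r0 r1)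
  also have "\<dots> = 2 * R" by (simp add: mult_2)
  \<comment> \<open>\<open>R\<close> may be infinite, so the bound on \<open>2 * R\<close> is halved
    by a multiplication in \<open>ennreal\<close>.\<close>
  finally have "ennreal (1 / 2) * ennreal (?d / 2) \<le> ennreal (1 / 2) * (2 * R)"
    by (intro mult_left_mono) auto
  also have "\<dots> = ennreal (1 / 2) * ennreal 2 * R" by (simp add: mult.assoc)
  also have "\<dots> = R" by (subst ennreal_mult'[symmetric]) auto
  also have "ennreal (1 / 2) * ennreal (?d / 2) = ennreal (?d / 4)"
    by (subst ennreal_mult'[symmetric]) auto
  finally show "ennreal (?d / 4) \<le> (SUP P \<in> \<P>. \<integral>\<^sup>+ z. ennreal \<bar>est z - \<theta> P\<bar> \<partial>(\<Pi>\<^sub>M i\<in>{..<N}. P))"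
    unfolding R_def .
qed

section \<open>The null law of an observation\<close>

lemma borel_obs: "(borel :: 'd::finite obs measure) = borel \<Otimes>\<^sub>M (borel \<Otimes>\<^sub>M borel)"
  by (simp only: borel_prod)

text \<open>The two-point law is transported to the Borel sets of the reals because
  \<open>plm_dist\<close> asks for the Borel algebra on triples.\<close>

definition sign_unif :: "real measure"
  where "sign_unif = distr (measure_pmf (pmf_of_set {-1, 1})) borel (\<lambda>x. x)"

definition obs_null :: "'d::finite obs measure"
  where "obs_null = cube_unif \<Otimes>\<^sub>M (sign_unif \<Otimes>\<^sub>M sign_unif)"

lemma sets_sign_unif [simp, measurable_cong]: "sets sign_unif = sets borel"
  by (simp add: sign_unif_def)

lemma space_sign_unif [simp]: "space sign_unif = UNIV"
  by (simp add: sign_unif_def)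

lemma prob_space_sign_unif: "prob_space sign_unif"
  unfolding sign_unif_def by (rule prob_space.prob_space_distr) (auto intro: prob_space_measure_pmf)

lemma integral_sign_unif: "g \<in> borel_measurable borel \<Longrightarrow> (\<integral>x. g x \<partial>sign_unif) = (g 1 + g (-1)) / (2 :: real)"
  unfolding sign_unif_def by (subst integral_distr) (auto simp: integral_pmf_of_set)

lemma AE_sign_unif:
  assumes [measurable]: "Measurable.pred borel P"
  shows "(AE x in sign_unif. P x) \<longleftrightarrow> P 1 \<and> P (-1)"
  unfolding sign_unif_def by (subst AE_distr_iff) (auto simp: AE_measure_pmf_iff)

lemma sets_obs_null [simp, measurable_cong]: "sets (obs_null :: 'd::finite obs measure) = sets borel"
proof -
  have "sets (obs_null :: 'd obs measure) = sets (borel \<Otimes>\<^sub>M (borel \<Otimes>\<^sub>M borel))"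
    unfolding obs_null_def by (intro sets_pair_measure_cong) simp_all
  then show ?thesis by (simp only: borel_obs)
qed

lemma space_obs_null [simp]: "space (obs_null :: 'd::finite obs measure) = UNIV"
  using sets_eq_imp_space_eq[OF sets_obs_null] by simp

lemma prob_space_obs_null: "prob_space (obs_null :: 'd::finite obs measure)"
  unfolding obs_null_def
  by (intro prob_space_pair prob_space_cube_unif prob_space_sign_unif)

lemma AE_obs_nullI:
  assumes P: "Measurable.pred borel P" and "\<And>x t y. t \<in> {1, -1} \<Longrightarrow> y \<in> {1, -1} \<Longrightarrow> P (x, t, y)"
  shows "AE z in (obs_null :: 'd::finite obs measure). P z"
proof -
  interpret C: prob_space "cube_unif :: (real ^ 'd) measure" by (rule prob_space_cube_unif)
  interpret S: prob_space sign_unif by (rule prob_space_sign_unif)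
  interpret SS: pair_prob_space sign_unif sign_unif ..
  interpret CSS: pair_prob_space "cube_unif :: (real ^ 'd) measure" "sign_unif \<Otimes>\<^sub>M sign_unif" ..
  have P'[measurable]: "Measurable.pred (borel \<Otimes>\<^sub>M (borel \<Otimes>\<^sub>M borel)) P"
    using P by (simp only: borel_obs)
  have s: "sets (sign_unif \<Otimes>\<^sub>M sign_unif) = sets (borel \<Otimes>\<^sub>M borel)"
    "sets ((cube_unif :: (real ^ 'd) measure) \<Otimes>\<^sub>M (sign_unif \<Otimes>\<^sub>M sign_unif)) = sets (borel \<Otimes>\<^sub>M (borel \<Otimes>\<^sub>M borel))"
    by (intro sets_pair_measure_cong; simp)+
  show ?thesis unfolding obs_null_def
  proof (rule CSS.AE_pair_measure)
    have "{z \<in> space (borel \<Otimes>\<^sub>M (borel \<Otimes>\<^sub>M borel)). P z} \<in> sets (borel \<Otimes>\<^sub>M (borel \<Otimes>\<^sub>M borel))"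
      by measurable
    then show "{z \<in> space (cube_unif \<Otimes>\<^sub>M sign_unif \<Otimes>\<^sub>M sign_unif). P z}
        \<in> sets (cube_unif \<Otimes>\<^sub>M sign_unif \<Otimes>\<^sub>M sign_unif)"
      unfolding s by (simp add: space_pair_measure)
    show "AE x in cube_unif. AE y in sign_unif \<Otimes>\<^sub>M sign_unif. P (x, y)"
    proof (rule AE_I2, rule SS.AE_pair_measure)
      fix x :: "real ^ 'd"
      have "{z \<in> space (borel \<Otimes>\<^sub>M borel). P (x, z)} \<in> sets (borel \<Otimes>\<^sub>M borel)"
        by measurable
      then show "{z \<in> space (sign_unif \<Otimes>\<^sub>M sign_unif). P (x, z)} \<in> sets (sign_unif \<Otimes>\<^sub>M sign_unif)"
        unfolding s by (simp add: space_pair_measure)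
      have [measurable]: "Measurable.pred borel (\<lambda>y. P (x, t, y))" for t by measurable
      have "AE t in sign_unif. t \<in> {1, -1}" by (subst AE_sign_unif) auto
      then show "AE t in sign_unif. AE y in sign_unif. P (x, t, y)"
        by eventually_elim (use assms(2) in \<open>auto simp: AE_sign_unif\<close>)
    qed
  qed
qed

text \<open>Fubini, followed by two averages over a sign. Later integrals thereby become four-term
  identities at each point of the cube. The bound is asked for at the atoms only, since integrands
  such as \<open>obs_T\<close> are unbounded elsewhere.\<close>

lemma integral_obs_null:
  fixes g :: "'d::finite obs \<Rightarrow> real"
  assumes g: "g \<in> borel_measurable borel"
    and B: "\<And>x t y. t \<in> {1, -1} \<Longrightarrow> y \<in> {1, -1} \<Longrightarrow> \<bar>g (x, t, y)\<bar> \<le> B"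
  shows "integrable obs_null g"
    and "(\<integral>z. g z \<partial>obs_null)
      = (\<integral>x. (g (x, 1, 1) + g (x, 1, -1) + g (x, -1, 1) + g (x, -1, -1)) / 4 \<partial>cube_unif)"
proof -
  interpret C: prob_space "cube_unif :: (real ^ 'd) measure" by (rule prob_space_cube_unif)
  interpret S: prob_space sign_unif by (rule prob_space_sign_unif)
  interpret SS: pair_prob_space sign_unif sign_unif ..
  interpret CSS: pair_prob_space "cube_unif :: (real ^ 'd) measure" "sign_unif \<Otimes>\<^sub>M sign_unif" ..
  interpret N: prob_space "obs_null :: 'd obs measure" by (rule prob_space_obs_null)
  note g[measurable]
  have g'[measurable]: "g \<in> borel_measurable (borel \<Otimes>\<^sub>M (borel \<Otimes>\<^sub>M borel))"
    using g by (simp only: borel_obs)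
  have "AE z in obs_null. \<bar>g z\<bar> \<le> B" by (rule AE_obs_nullI) (use B in auto)
  then show i: "integrable obs_null g"
    by (intro N.integrable_const_bound[where B = B]) auto
  have "(\<integral>z. g z \<partial>obs_null) = (\<integral>x. (\<integral>w. g (x, w) \<partial>(sign_unif \<Otimes>\<^sub>M sign_unif)) \<partial>cube_unif)"
    using i unfolding obs_null_def by (rule CSS.integral_fst'[symmetric])
  also have "\<dots> = (\<integral>x. (g (x, 1, 1) + g (x, 1, -1) + g (x, -1, 1) + g (x, -1, -1)) / 4 \<partial>cube_unif)"
  proof (rule Bochner_Integration.integral_cong[OF refl])
    fix x :: "real ^ 'd"
    have gx: "(\<lambda>w. g (x, w)) \<in> borel_measurable (borel \<Otimes>\<^sub>M borel)" by measurable
    have s: "sets (sign_unif \<Otimes>\<^sub>M sign_unif) = sets (borel \<Otimes>\<^sub>M borel)"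
      by (intro sets_pair_measure_cong; simp)
    have gx': "(\<lambda>w. g (x, w)) \<in> borel_measurable (sign_unif \<Otimes>\<^sub>M sign_unif)"
      using gx measurable_cong_sets[OF s refl] by blast
    have m[measurable]: "(\<lambda>y. g (x, t, y)) \<in> borel_measurable borel" for t by measurable
    have "AE w in sign_unif \<Otimes>\<^sub>M sign_unif. \<bar>g (x, w)\<bar> \<le> B"
    proof (rule SS.AE_pair_measure)
      show "{w \<in> space (sign_unif \<Otimes>\<^sub>M sign_unif). \<bar>g (x, w)\<bar> \<le> B} \<in> sets (sign_unif \<Otimes>\<^sub>M sign_unif)"
        using gx' by measurable
      have "AE t in sign_unif. t \<in> {1, -1}" by (subst AE_sign_unif) auto
      then show "AE t in sign_unif. AE y in sign_unif. \<bar>g (x, t, y)\<bar> \<le> B"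
        by eventually_elim (use B in \<open>auto simp: AE_sign_unif\<close>)
    qed
    then have "integrable (sign_unif \<Otimes>\<^sub>M sign_unif) (\<lambda>w. g (x, w))"
      using gx' by (intro SS.integrable_const_bound[where B = B]) auto
    from SS.integral_fst'[OF this]
    have "(\<integral>w. g (x, w) \<partial>(sign_unif \<Otimes>\<^sub>M sign_unif)) = (\<integral>t. (\<integral>y. g (x, t, y) \<partial>sign_unif) \<partial>sign_unif)"
      by simp
    also have "\<dots> = (\<integral>t. (g (x, t, 1) + g (x, t, -1)) / 2 \<partial>sign_unif)"
      by (simp add: integral_sign_unif)
    also have "\<dots> = (g (x, 1, 1) + g (x, 1, -1) + g (x, -1, 1) + g (x, -1, -1)) / 4"
      by (subst integral_sign_unif) (auto simp: field_simps)
    finally show "(\<integral>w. g (x, w) \<partial>(sign_unif \<Otimes>\<^sub>M sign_unif))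
        = (g (x, 1, 1) + g (x, 1, -1) + g (x, -1, 1) + g (x, -1, -1)) / 4" .
  qed
  finally show "(\<integral>z. g z \<partial>obs_null)
      = (\<integral>x. (g (x, 1, 1) + g (x, 1, -1) + g (x, -1, 1) + g (x, -1, -1)) / 4 \<partial>cube_unif)" .
qed

section \<open>Conditional means and the densities of the alternatives\<close>

text \<open>Each conditional moment in the model is a constant, 0 or \<open>v\<close>. By the
  characterisation of conditional expectations, this amounts to \<open>f - c\<close> being
  orthogonal to the indicators of the events \<open>Z \<in> B\<close>, which make up the algebra
  generated by \<open>Z\<close>.\<close>

lemma cond_mean_eq_const:
  fixes Z :: "'a \<Rightarrow> 'b::topological_space"
  assumes P: "prob_space P" and Z: "Z \<in> borel_measurable P" and f: "integrable P f"
    and orth: "\<And>B. B \<in> sets borel \<Longrightarrow> (\<integral>z. indicator B (Z z) * (f z - c) \<partial>P) = 0"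
  shows "AE z in P. cond_mean P Z f z = c"
proof -
  interpret prob_space P by fact
  let ?F = "vimage_algebra (space P) Z borel"
  have sub: "subalgebra P ?F"
    unfolding subalgebra_def using measurable_sets[OF Z] by (auto simp: sets_vimage_algebra2)
  interpret F: finite_measure_subalgebra P ?F by standard (rule sub)
  show ?thesis unfolding cond_mean_def
  proof (rule F.real_cond_exp_charact)
    fix A assume "A \<in> sets ?F"
    then obtain B where B: "B \<in> sets borel" "A = Z -` B \<inter> space P" by (auto simp: sets_vimage_algebra2)
    have A: "A \<in> sets P" using B measurable_sets[OF Z] by blast
    have "0 = (\<integral>z. indicator B (Z z) * (f z - c) \<partial>P)" using orth[OF B(1)] by simp
    also have "\<dots> = (\<integral>z. indicator A z * f z - indicator A z * c \<partial>P)"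
      by (intro Bochner_Integration.integral_cong) (auto simp: B indicator_def)
    also have "\<dots> = (\<integral>z. indicator A z * f z \<partial>P) - (\<integral>z. indicator A z * c \<partial>P)"
      using integrable_mult_indicator[OF A f] integrable_mult_indicator[OF A integrable_const[of c]]
      by (intro Bochner_Integration.integral_diff) simp_all
    finally show "(\<integral>z\<in>A. f z \<partial>P) = (\<integral>z\<in>A. c \<partial>P)"
      by (simp add: set_lebesgue_integral_def)
  qed (use f in auto)
qed

text \<open>Only \<open>T, Y \<in> {-1, 1}\<close> matter; the function \<open>sgn\<close> makes the density nonnegative and bounded
  everywhere.\<close>

definition plm_density :: "real \<Rightarrow> real \<Rightarrow> real \<Rightarrow> (real ^ 'd::finite \<Rightarrow> real) \<Rightarrow> 'd obs \<Rightarrow> real"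
  where "plm_density \<beta> a b h z =
    (1 + a * h (obs_X z) * sgn (obs_T z)) * (1 + (\<beta> * sgn (obs_T z) + b * h (obs_X z)) * sgn (obs_Y z))"

lemma plm_density_measurable [measurable]:
  assumes [measurable]: "h \<in> borel_measurable borel"
  shows "plm_density \<beta> a b h \<in> borel_measurable borel"
  unfolding plm_density_def[abs_def] by measurable

lemma plm_density_bounds:
  assumes h: "\<And>x. \<bar>h x\<bar> \<le> 1" and a: "\<bar>a\<bar> \<le> 1" and b: "\<bar>\<beta>\<bar> + \<bar>b\<bar> \<le> 1"
  shows "0 \<le> plm_density \<beta> a b h z" "plm_density \<beta> a b h z \<le> 4"
proof -
  have s: "\<bar>sgn t\<bar> \<le> 1" for t :: real by (simp add: sgn_real_def)
  have "\<bar>a * h (obs_X z) * sgn (obs_T z)\<bar> \<le> 1 * 1 * 1"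
    unfolding abs_mult using h a s by (intro mult_mono) auto
  then have 1: "0 \<le> 1 + a * h (obs_X z) * sgn (obs_T z)" "1 + a * h (obs_X z) * sgn (obs_T z) \<le> 2"
    by linarith+
  have "\<bar>\<beta> * sgn (obs_T z)\<bar> \<le> \<bar>\<beta>\<bar>" "\<bar>b * h (obs_X z)\<bar> \<le> \<bar>b\<bar>"
    using s[of "obs_T z"] h[of "obs_X z"] by (simp_all add: abs_mult mult_left_le)
  then have "\<bar>\<beta> * sgn (obs_T z) + b * h (obs_X z)\<bar> \<le> 1" using b by linarith
  then have "\<bar>(\<beta> * sgn (obs_T z) + b * h (obs_X z)) * sgn (obs_Y z)\<bar> \<le> 1 * 1"
    unfolding abs_mult using s by (intro mult_mono) auto
  then have 2: "0 \<le> 1 + (\<beta> * sgn (obs_T z) + b * h (obs_X z)) * sgn (obs_Y z)"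
    "1 + (\<beta> * sgn (obs_T z) + b * h (obs_X z)) * sgn (obs_Y z) \<le> 2"
    by linarith+
  show "0 \<le> plm_density \<beta> a b h z" unfolding plm_density_def using 1 2 by simp
  have "plm_density \<beta> a b h z \<le> 2 * 2" unfolding plm_density_def using 1 2 by (intro mult_mono) auto
  then show "plm_density \<beta> a b h z \<le> 4" by simp
qed

lemma integral_plm:
  fixes h :: "real ^ 'd::finite \<Rightarrow> real" and g :: "'d obs \<Rightarrow> real"
  assumes h: "h \<in> borel_measurable borel" "\<And>x. \<bar>h x\<bar> \<le> 1" and ab: "\<bar>a\<bar> \<le> 1" "\<bar>\<beta>\<bar> + \<bar>b\<bar> \<le> 1"
    and g: "g \<in> borel_measurable borel"
    and B: "\<And>x t y. t \<in> {1, -1} \<Longrightarrow> y \<in> {1, -1} \<Longrightarrow> \<bar>g (x, t, y)\<bar> \<le> B"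
  defines "G \<equiv> \<lambda>z. plm_density \<beta> a b h z * g z"
  shows "integrable (density obs_null (plm_density \<beta> a b h)) g"
    and "(\<integral>z. g z \<partial>density obs_null (plm_density \<beta> a b h))
      = (\<integral>x. (G (x, 1, 1) + G (x, 1, -1) + G (x, -1, 1) + G (x, -1, -1)) / 4 \<partial>cube_unif)"
proof -
  note bd = plm_density_bounds[where h = h, OF h(2) ab]
  note [measurable] = h(1) g
  have f: "plm_density \<beta> a b h \<in> borel_measurable obs_null" "AE z in obs_null. 0 \<le> plm_density \<beta> a b h z"
    "g \<in> borel_measurable obs_null"
    using g by (auto intro!: AE_I2 bd(1) simp del: split_paired_All)
  have G: "G \<in> borel_measurable borel" unfolding G_def by measurable
  have GB: "\<bar>G (x, t, y)\<bar> \<le> 4 * B" if "t \<in> {1, -1}" "y \<in> {1, -1}" for x t y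
    unfolding G_def abs_mult using bd[of "(x, t, y)"] B[OF that] by (intro mult_mono) auto
  show "integrable (density obs_null (plm_density \<beta> a b h)) g"
    using integral_obs_null(1)[of G, OF G GB] integrable_real_density[OF f] by (simp add: G_def)
  show "(\<integral>z. g z \<partial>density obs_null (plm_density \<beta> a b h))
      = (\<integral>x. (G (x, 1, 1) + G (x, 1, -1) + G (x, -1, 1) + G (x, -1, -1)) / 4 \<partial>cube_unif)"
    using integral_obs_null(2)[of G, OF G GB] integral_real_density[OF f] by (simp add: G_def)
qed

lemma prob_space_plm:
  fixes h :: "real ^ 'd::finite \<Rightarrow> real"
  assumes h: "h \<in> borel_measurable borel" "\<And>x. \<bar>h x\<bar> \<le> 1" and ab: "\<bar>a\<bar> \<le> 1" "\<bar>\<beta>\<bar> + \<bar>b\<bar> \<le> 1"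
  shows "prob_space (density obs_null (plm_density \<beta> a b h))"
proof -
  note bd = plm_density_bounds[where h = h, OF h(2) ab]
  note [measurable] = h(1)
  interpret C: prob_space "cube_unif :: (real ^ 'd) measure" by (rule prob_space_cube_unif)
  have f: "integrable obs_null (plm_density \<beta> a b h)"
    and i: "(\<integral>z. plm_density \<beta> a b h z \<partial>obs_null) = 1"
  proof -
    note int = integral_obs_null[of "plm_density \<beta> a b h" 4]
    show "integrable obs_null (plm_density \<beta> a b h)"
      by (rule int(1)) (use bd in auto)
    \<comment> \<open>Every term of the expanded density except 1 is odd in one of the two signs and
      cancels over the four atoms.\<close>
    have "(\<integral>z. plm_density \<beta> a b h z \<partial>obs_null) = (\<integral>x. 1 \<partial>(cube_unif :: (real ^ 'd) measure))"
    proof (subst int(2))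
      show "\<bar>plm_density \<beta> a b h (x, t, y)\<bar> \<le> 4" for x t y
        using bd[of "(x, t, y)"] by linarith
    qed (auto simp: plm_density_def obs_X_def obs_T_def obs_Y_def algebra_simps)
    then show "(\<integral>z. plm_density \<beta> a b h z \<partial>obs_null) = 1"
      using C.prob_space by simp
  qed
  show ?thesis
  proof
    have "emeasure (density obs_null (plm_density \<beta> a b h)) UNIV
        = (\<integral>\<^sup>+z. ennreal (plm_density \<beta> a b h z) \<partial>obs_null)"
      by (subst emeasure_density) auto
    also have "\<dots> = 1" using f bd i by (subst nn_integral_eq_integral) auto
    finally show "emeasure (density obs_null (plm_density \<beta> a b h))
        (space (density obs_null (plm_density \<beta> a b h))) = 1" by simp
  qed
qed

text \<open>The first factor of the density is the law of T given X, a sign of mean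
  \<open>a * h X\<close>; the second is the law of Y given X and T, a sign of mean
  \<open>\<beta> * T + b * h X\<close>. Averaging out both signs leaves X uniform.\<close>

lemma plm_dist_density:
  fixes h :: "real ^ 'd::finite \<Rightarrow> real"
  assumes h: "h \<in> borel_measurable borel" "\<And>x. h x \<in> {1, -1}" and ab: "\<bar>a\<bar> \<le> 1" "\<bar>\<beta>\<bar> + \<bar>b\<bar> \<le> 1"
  shows "plm_dist \<beta> (1 - a\<^sup>2) (\<lambda>x. b * h x) (\<lambda>x. a * h x) (density obs_null (plm_density \<beta> a b h))"
proof -
  let ?P = "density obs_null (plm_density \<beta> a b h)"
  have h1: "\<bar>h x\<bar> \<le> 1" for x using h(2)[of x] by auto
  have hb: "\<bar>c * h x\<bar> \<le> \<bar>c\<bar>" for x c using h(2)[of x] by auto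
  note [measurable] = h(1)
  note bd = plm_density_bounds[where h = h, OF h1 ab]
  note int = integral_plm[OF h(1) h1 ab]
  interpret P: prob_space ?P by (rule prob_space_plm[OF h(1) h1 ab])
  interpret C: prob_space "cube_unif :: (real ^ 'd) measure" by (rule prob_space_cube_unif)
  have ae: "AE z in ?P. R z" if "Measurable.pred borel R"
    "\<And>x t y. t \<in> {1, -1} \<Longrightarrow> y \<in> {1, -1} \<Longrightarrow> R (x, t, y)" for R
    using AE_obs_nullI[OF that] by (subst AE_density) (auto elim!: eventually_mono)
  have XT[measurable]: "(\<lambda>z :: 'd obs. (obs_X z, obs_T z)) \<in> borel_measurable borel"
  proof -
    have "(\<lambda>z :: 'd obs. (obs_X z, obs_T z)) \<in> borel \<rightarrow>\<^sub>M borel \<Otimes>\<^sub>M borel" by measurable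
    then show ?thesis by (simp only: borel_prod)
  qed
  have abs2: "\<bar>w\<bar> \<le> 1 \<Longrightarrow> 0 \<le> c \<Longrightarrow> \<bar>u\<bar> \<le> c \<Longrightarrow> \<bar>w * u\<bar> \<le> c" for w u c :: real
    unfolding abs_mult using mult_mono[of "\<bar>w\<bar>" 1 "\<bar>u\<bar>" c] by auto
  have ind: "\<bar>indicator A w\<bar> \<le> (1 :: real)" for A and w :: 'w by (auto simp: indicator_def)
  have "distr ?P borel obs_X = cube_unif"
  proof (rule measure_eqI)
    fix A assume "A \<in> sets (distr ?P borel (obs_X :: 'd obs \<Rightarrow> _))"
    then have A[measurable]: "A \<in> sets borel" by simp
    have "measure (distr ?P borel obs_X) A = (\<integral>x. indicator A x \<partial>distr ?P borel obs_X)" by simp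
    also have "\<dots> = (\<integral>z. indicator A (obs_X z) \<partial>?P)" by (rule integral_distr) simp_all
    also have "\<dots> = (\<integral>x. indicator A x \<partial>cube_unif)"
    proof (subst int(2)[where B = 1])
      show "(\<lambda>z :: 'd obs. indicator A (obs_X z) :: real) \<in> borel_measurable borel" by measurable
    qed (auto simp: plm_density_def obs_X_def obs_T_def obs_Y_def algebra_simps intro: ind)
    also have "\<dots> = measure cube_unif A" by simp
    finally have "measure (distr ?P borel obs_X) A = measure cube_unif A" .
    moreover have "prob_space (distr ?P borel (obs_X :: 'd obs \<Rightarrow> _))"
      by (rule P.prob_space_distr) simp
    ultimately show "emeasure (distr ?P borel obs_X) A = emeasure cube_unif A"
      by (simp add: C.emeasure_eq_measure finite_measure.emeasure_eq_measure prob_space.axioms(1))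
  qed simp
  moreover have "AE z in ?P. cond_mean ?P obs_X (\<lambda>z. obs_T z - a * h (obs_X z)) z = 0"
  proof (rule cond_mean_eq_const[OF P.prob_space_axioms])
    have B: "\<bar>obs_T (x, t, y) - a * h (obs_X (x, t, y))\<bar> \<le> 2" if "t \<in> {1, -1}" for x :: "real ^ 'd" and t y :: real
      using hb[of a x] ab that by (auto simp: obs_T_def obs_X_def)
    show "integrable ?P (\<lambda>z. obs_T z - a * h (obs_X z))"
      by (rule int(1)[where B = 2], measurable) (rule B)
    fix A :: "(real ^ 'd) set" assume [measurable]: "A \<in> sets borel"
    have "(\<integral>z. indicator A (obs_X z) * (obs_T z - a * h (obs_X z) - 0) \<partial>?P) = (\<integral>x. 0 \<partial>(cube_unif :: (real ^ 'd) measure))"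
    proof (subst int(2)[where B = 2])
      show "(\<lambda>z. indicator A (obs_X z) * (obs_T z - a * h (obs_X z) - 0)) \<in> borel_measurable borel"
        by measurable
      show "\<bar>indicator A (obs_X (x, t, y)) * (obs_T (x, t, y) - a * h (obs_X (x, t, y)) - 0)\<bar> \<le> 2"
        if "t \<in> {1, -1}" for x t y using B[OF that] by (intro abs2 ind) auto
    qed (auto simp: plm_density_def obs_X_def obs_T_def obs_Y_def algebra_simps intro!: Bochner_Integration.integral_cong)
    then show "(\<integral>z. indicator A (obs_X z) * (obs_T z - a * h (obs_X z) - 0) \<partial>?P) = 0" by simp
  qed simp
  moreover have "AE z in ?P. cond_mean ?P obs_X (\<lambda>z. (obs_T z - a * h (obs_X z))\<^sup>2) z = 1 - a\<^sup>2"
  proof (rule cond_mean_eq_const[OF P.prob_space_axioms])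
    have a2: "a\<^sup>2 \<le> 1" using ab by (simp add: abs_square_le_1)
    have B: "\<bar>(obs_T (x, t, y) - a * h (obs_X (x, t, y)))\<^sup>2\<bar> \<le> 4" if "t \<in> {1, -1}" for x :: "real ^ 'd" and t y :: real
    proof -
      have "\<bar>obs_T (x, t, y) - a * h (obs_X (x, t, y))\<bar> \<le> 2"
        using hb[of a x] ab that by (auto simp: obs_T_def obs_X_def)
      then have "\<bar>obs_T (x, t, y) - a * h (obs_X (x, t, y))\<bar>\<^sup>2 \<le> 2\<^sup>2" by (intro power_mono) auto
      then show ?thesis by simp
    qed
    show "integrable ?P (\<lambda>z. (obs_T z - a * h (obs_X z))\<^sup>2)"
      by (rule int(1)[where B = 4], measurable) (rule B)
    fix A :: "(real ^ 'd) set" assume [measurable]: "A \<in> sets borel"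
    have "(\<integral>z. indicator A (obs_X z) * ((obs_T z - a * h (obs_X z))\<^sup>2 - (1 - a\<^sup>2)) \<partial>?P) = (\<integral>x. 0 \<partial>(cube_unif :: (real ^ 'd) measure))"
    proof (subst int(2)[where B = 6])
      show "\<bar>indicator A (obs_X (x, t, y)) * ((obs_T (x, t, y) - a * h (obs_X (x, t, y)))\<^sup>2 - (1 - a\<^sup>2))\<bar> \<le> 6"
        if "t \<in> {1, -1}" for x t y
      proof (intro abs2 ind)
        show "\<bar>(obs_T (x, t, y) - a * h (obs_X (x, t, y)))\<^sup>2 - (1 - a\<^sup>2)\<bar> \<le> 6"
          using B[OF that, of x y] a2 zero_le_power2[of a] by linarith
      qed simp
      \<comment> \<open>A sign of mean m has variance \<open>1 - m\<^sup>2\<close>. With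
        \<open>m = a * h x\<close> this is constant in x because \<open>h\<close> takes the values 1
        and -1 only, whence the case split on \<open>h x\<close>.\<close>
      show "(\<integral>x. (plm_density \<beta> a b h (x, 1, 1) * (indicator A (obs_X (x, 1, 1)) * ((obs_T (x, 1, 1) - a * h (obs_X (x, 1, 1)))\<^sup>2 - (1 - a\<^sup>2))) +
          plm_density \<beta> a b h (x, 1, -1) * (indicator A (obs_X (x, 1, -1)) * ((obs_T (x, 1, -1) - a * h (obs_X (x, 1, -1)))\<^sup>2 - (1 - a\<^sup>2))) +
          plm_density \<beta> a b h (x, -1, 1) * (indicator A (obs_X (x, -1, 1)) * ((obs_T (x, -1, 1) - a * h (obs_X (x, -1, 1)))\<^sup>2 - (1 - a\<^sup>2))) +
          plm_density \<beta> a b h (x, -1, -1) * (indicator A (obs_X (x, -1, -1)) * ((obs_T (x, -1, -1) - a * h (obs_X (x, -1, -1)))\<^sup>2 - (1 - a\<^sup>2)))) / 4 \<partial>cube_unif)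
        = (\<integral>x. 0 \<partial>(cube_unif :: (real ^ 'd) measure))"
      proof (rule Bochner_Integration.integral_cong[OF refl], goal_cases)
        case (1 x)
        then show ?case using h(2)[of x]
          by (auto simp: plm_density_def obs_X_def obs_T_def obs_Y_def power2_eq_square algebra_simps)
      qed
    qed auto
    then show "(\<integral>z. indicator A (obs_X z) * ((obs_T z - a * h (obs_X z))\<^sup>2 - (1 - a\<^sup>2)) \<partial>?P) = 0" by simp
  qed simp
  moreover have "AE z in ?P. cond_mean ?P (\<lambda>z. (obs_X z, obs_T z)) (\<lambda>z. obs_Y z - \<beta> * obs_T z - b * h (obs_X z)) z = 0"
  proof (rule cond_mean_eq_const[OF P.prob_space_axioms])
    have B: "\<bar>obs_Y (x, t, y) - \<beta> * obs_T (x, t, y) - b * h (obs_X (x, t, y))\<bar> \<le> 2"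
      if "t \<in> {1, -1}" "y \<in> {1, -1}" for x :: "real ^ 'd" and t y :: real
      using hb[of b x] ab that by (auto simp: obs_T_def obs_X_def obs_Y_def)
    show "integrable ?P (\<lambda>z. obs_Y z - \<beta> * obs_T z - b * h (obs_X z))"
      by (rule int(1)[where B = 2], measurable) (rule B)
    fix A :: "((real ^ 'd) \<times> real) set" assume A[measurable]: "A \<in> sets borel"
    have [measurable]: "(\<lambda>z :: 'd obs. indicator A (obs_X z, obs_T z) :: real) \<in> borel_measurable borel"
      by (rule measurable_compose[OF XT]) measurable
    have "(\<integral>z. indicator A (obs_X z, obs_T z) * (obs_Y z - \<beta> * obs_T z - b * h (obs_X z) - 0) \<partial>?P)
        = (\<integral>x. 0 \<partial>(cube_unif :: (real ^ 'd) measure))"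
    proof (subst int(2)[where B = 2])
      show "(\<lambda>z. indicator A (obs_X z, obs_T z) * (obs_Y z - \<beta> * obs_T z - b * h (obs_X z) - 0))
          \<in> borel_measurable borel"
        by measurable
      show "\<bar>indicator A (obs_X (x, t, y), obs_T (x, t, y)) *
          (obs_Y (x, t, y) - \<beta> * obs_T (x, t, y) - b * h (obs_X (x, t, y)) - 0)\<bar> \<le> 2"
        if "t \<in> {1, -1}" "y \<in> {1, -1}" for x t y using B[OF that] by (intro abs2 ind) auto
    qed (auto simp: plm_density_def obs_X_def obs_T_def obs_Y_def algebra_simps intro!: Bochner_Integration.integral_cong)
    then show "(\<integral>z. indicator A (obs_X z, obs_T z) * (obs_Y z - \<beta> * obs_T z - b * h (obs_X z) - 0) \<partial>?P) = 0" by simp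
  qed simp
  moreover have "AE z in ?P. \<bar>obs_T z\<bar> \<le> 3" "AE z in ?P. \<bar>obs_Y z\<bar> \<le> 3"
    by (rule ae, measurable, (auto simp: obs_T_def obs_Y_def)[1])+
  ultimately show ?thesis
    unfolding plm_dist_def using P.prob_space_axioms by simp
qed

text \<open>Given X, the functions 1, T, Y and TY are orthonormal under the null law. Since the
  squares of \<open>h\<close> and \<open>h'\<close> are 1, the coefficients are 1,
  \<open>a * h\<close>, \<open>(b + a * \<beta>) * h\<close> and \<open>\<beta> + a * b\<close>, and
  likewise for \<open>h'\<close>; the inner product is the sum of the products of matching
  coefficients.\<close>

lemma integral_plm_density_mult:
  fixes h h' :: "real ^ 'd::finite \<Rightarrow> real"
  assumes h: "h \<in> borel_measurable borel" "\<And>x. h x \<in> {1, -1}"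
    and h': "h' \<in> borel_measurable borel" "\<And>x. h' x \<in> {1, -1}"
    and ab: "\<bar>a\<bar> \<le> 1" "\<bar>\<beta>\<bar> + \<bar>b\<bar> \<le> 1"
  shows "(\<integral>z. plm_density \<beta> a b h z * plm_density \<beta> a b h' z \<partial>obs_null)
    = 1 + (\<beta> + a * b)\<^sup>2 + (a\<^sup>2 + (b + a * \<beta>)\<^sup>2) * (\<integral>x. h x * h' x \<partial>cube_unif)"
proof -
  interpret C: prob_space "cube_unif :: (real ^ 'd) measure" by (rule prob_space_cube_unif)
  note [measurable] = h(1) h'(1)
  have h1: "\<bar>h x\<bar> \<le> 1" "\<bar>h' x\<bar> \<le> 1" for x using h(2)[of x] h'(2)[of x] by auto
  note bd = plm_density_bounds[where h = h, OF h1(1) ab] plm_density_bounds[where h = h', OF h1(2) ab]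
  have i: "integrable (cube_unif :: (real ^ 'd) measure) (\<lambda>x. h x * h' x)"
    by (rule C.integrable_const_bound[where B = 1]) (auto simp: abs_mult intro!: AE_I2 mult_le_one h1)
  have "(\<integral>z. plm_density \<beta> a b h z * plm_density \<beta> a b h' z \<partial>obs_null)
     = (\<integral>x. 1 + (\<beta> + a * b)\<^sup>2 + (a\<^sup>2 + (b + a * \<beta>)\<^sup>2) * (h x * h' x) \<partial>cube_unif)"
  proof (subst integral_obs_null(2)[where B = "4 * 4"])
    show "\<bar>plm_density \<beta> a b h (x, t, y) * plm_density \<beta> a b h' (x, t, y)\<bar> \<le> 4 * 4" for x t y
      unfolding abs_mult using bd by (intro mult_mono) auto
    show "(\<integral>x. (plm_density \<beta> a b h (x, 1, 1) * plm_density \<beta> a b h' (x, 1, 1)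
        + plm_density \<beta> a b h (x, 1, -1) * plm_density \<beta> a b h' (x, 1, -1)
        + plm_density \<beta> a b h (x, -1, 1) * plm_density \<beta> a b h' (x, -1, 1)
        + plm_density \<beta> a b h (x, -1, -1) * plm_density \<beta> a b h' (x, -1, -1)) / 4 \<partial>cube_unif)
      = (\<integral>x. 1 + (\<beta> + a * b)\<^sup>2 + (a\<^sup>2 + (b + a * \<beta>)\<^sup>2) * (h x * h' x) \<partial>cube_unif)"
    proof (rule Bochner_Integration.integral_cong[OF refl], goal_cases)
      case (1 x)
      then show ?case using h(2)[of x] h'(2)[of x]
        by (auto simp: plm_density_def obs_X_def obs_T_def obs_Y_def power2_eq_square algebra_simps)
    qed
  qed measurable
  also have "\<dots> = 1 + (\<beta> + a * b)\<^sup>2 + (a\<^sup>2 + (b + a * \<beta>)\<^sup>2) * (\<integral>x. h x * h' x \<partial>cube_unif)"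
    using i C.prob_space by simp
  finally show ?thesis .
qed

section \<open>Minimax bound from random sign patterns\<close>

text \<open>The bound on \<open>a\<^sup>2\<close> keeps the variance \<open>1 - a\<^sup>2\<close> at
  or above 1/3, and the one on \<open>\<bar>\<beta>\<bar> + \<bar>b\<bar>\<close> keeps the
  densities nonnegative. \<beta> is left free so that both uses are covered:
  \<open>- (a * b)\<close>, where \<open>(\<beta> + a * b)\<^sup>2\<close> vanishes, and a = b = 0,
  where only this term remains.\<close>

lemma minimax_risk_sign_mixture:
  fixes h :: "'w \<Rightarrow> real ^ 'd::finite \<Rightarrow> real"
  assumes W: "finite W" "W \<noteq> {}"
    and h: "\<And>w. w \<in> W \<Longrightarrow> h w \<in> borel_measurable borel" "\<And>w x. w \<in> W \<Longrightarrow> h w x \<in> {1, -1}"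
    and ab: "a\<^sup>2 \<le> 2 / 3" "\<bar>\<beta>\<bar> + \<bar>b\<bar> \<le> 1"
    and F: "F\<^sub>\<mu> \<subseteq> bdd_class" "F\<^sub>\<pi> \<subseteq> bdd_class" "(\<lambda>x. 0) \<in> F\<^sub>\<mu>" "(\<lambda>x. 0) \<in> F\<^sub>\<pi>"
      "\<And>w. w \<in> W \<Longrightarrow> (\<lambda>x. b * h w x) \<in> F\<^sub>\<mu>" "\<And>w. w \<in> W \<Longrightarrow> (\<lambda>x. a * h w x) \<in> F\<^sub>\<pi>"
    and moment: "(\<Sum>w\<in>W. \<Sum>w'\<in>W. (1 + (\<beta> + a * b)\<^sup>2
        + (a\<^sup>2 + (b + a * \<beta>)\<^sup>2) * (\<integral>x. h w x * h w' x \<partial>cube_unif)) ^ N) \<le> 2 * (real (card W))\<^sup>2"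
  shows "minimax_risk N (plm_family F\<^sub>\<mu> F\<^sub>\<pi>) target \<ge> ennreal (\<bar>\<beta>\<bar> / 4)"
proof -
  have a1: "\<bar>a\<bar> \<le> 1" using ab(1) by (simp add: flip: abs_square_le_1)
  have mem: "P \<in> plm_family F\<^sub>\<mu> F\<^sub>\<pi> \<and> target P = \<gamma>"
    if "plm_dist \<gamma> v \<mu> \<pi> P" "\<bar>\<gamma>\<bar> \<le> 3" "v \<in> {1/3..3}" "\<mu> \<in> F\<^sub>\<mu>" "\<pi> \<in> F\<^sub>\<pi>"
    for \<gamma> v \<mu> \<pi> and P :: "'d obs measure"
    using that F(1,2) target_eq[OF that(1)] unfolding plm_family_def by (fastforce simp: abs_le_iff)
  \<comment> \<open>With zero coefficients the density is 1, so the null law is itself a model law,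
    with \<beta> = 0, v = 1 and zero nuisance functions.\<close>
  have "density obs_null (plm_density 0 0 0 (\<lambda>x. 1)) = (obs_null :: 'd obs measure)"
    by (simp add: plm_density_def[abs_def] density_1)
  with plm_dist_density[of "\<lambda>x :: real ^ 'd. 1" 0 0 0]
  have "plm_dist 0 1 (\<lambda>x. 0) (\<lambda>x. 0) (obs_null :: 'd obs measure)" by simp
  from mem[OF this] F have null: "obs_null \<in> plm_family F\<^sub>\<mu> F\<^sub>\<pi>" "target (obs_null :: 'd obs measure) = 0"
    by auto
  have v: "1 - a\<^sup>2 \<in> {1/3..3}" 
    using ab(1) zero_le_power2[of a] by (intro atLeastAtMost_iff[THEN iffD2] conjI; linarith)
  have alt: "density obs_null (plm_density \<beta> a b (h w)) \<in> plm_family F\<^sub>\<mu> F\<^sub>\<pi>"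
      "target (density obs_null (plm_density \<beta> a b (h w))) = \<beta>" if w: "w \<in> W" for w
    using mem[OF plm_dist_density[OF h[OF w] a1 ab(2)] _ v F(5,6)[OF w]] ab(2) by auto
  have h1: "\<bar>h w x\<bar> \<le> 1" if "w \<in> W" for w x using h(2)[OF that, of x] by auto
  have "ennreal (\<bar>\<beta> - 0\<bar> / 4) \<le> minimax_risk N (plm_family F\<^sub>\<mu> F\<^sub>\<pi>) target"
  proof (rule minimax_risk_mixture[where Q = obs_null and f = "\<lambda>w. plm_density \<beta> a b (h w)" and \<theta> = target,
        OF prob_space_obs_null sets_obs_null null W])
    fix w assume w: "w \<in> W"
    show "plm_density \<beta> a b (h w) \<in> borel_measurable obs_null"
      using plm_density_measurable[OF h(1)[OF w]] by simp
    show "0 \<le> plm_density \<beta> a b (h w) z" "plm_density \<beta> a b (h w) z \<le> 4" for z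
      using plm_density_bounds[where h = "h w", OF h1[OF w] a1 ab(2)] by auto
    show "prob_space (density obs_null (plm_density \<beta> a b (h w)))"
      by (rule prob_space_plm[OF h(1)[OF w] h1[OF w] a1 ab(2)])
  next
    have "(\<integral>z. plm_density \<beta> a b (h w) z * plm_density \<beta> a b (h w') z \<partial>obs_null)
        = 1 + (\<beta> + a * b)\<^sup>2 + (a\<^sup>2 + (b + a * \<beta>)\<^sup>2) * (\<integral>x. h w x * h w' x \<partial>cube_unif)"
      if "w \<in> W" "w' \<in> W" for w w'
      using that h a1 ab(2) by (intro integral_plm_density_mult) auto
    then show "(\<Sum>w\<in>W. \<Sum>w'\<in>W. (\<integral>z. plm_density \<beta> a b (h w) z * plm_density \<beta> a b (h w') z \<partial>obs_null) ^ N)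
        \<le> 2 * (real (card W))\<^sup>2"
      using moment by simp
  qed (use alt in auto)
  then show ?thesis by simp
qed

section \<open>Rademacher features on cells\<close>

definition rademacher :: "nat \<Rightarrow> nat set \<Rightarrow> real"
  where "rademacher k S = (if k \<in> S then -1 else 1)"

lemma sum_rademacher_mult:
  assumes A: "finite A" "k \<in> A" "k' \<in> A"
  shows "(\<Sum>S\<in>Pow A. rademacher k S * rademacher k' S) = (if k = k' then 2 ^ card A else 0)"
proof (cases "k = k'")
  case True
  moreover have "rademacher k S * rademacher k S = 1" for S by (simp add: rademacher_def)
  ultimately show ?thesis using A by (simp add: card_Pow)
next
  case False
  \<comment> \<open>Toggling the membership of \<open>k\<close> is an involution of
    \<open>Pow A\<close> that reverses the sign at \<open>k\<close> and keeps the one at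
    \<open>k'\<close>, so the sum equals its own negative.\<close>
  define flip where "flip S = (if k \<in> S then S - {k} else insert k S)" for S
  have "(\<Sum>S\<in>Pow A. rademacher k S * rademacher k' S) = (\<Sum>S\<in>Pow A. - (rademacher k S * rademacher k' S))"
    by (rule sum.reindex_bij_witness[of _ flip flip])
      (use False A in \<open>auto simp: flip_def rademacher_def\<close>)
  then show ?thesis using False by (simp add: sum_negf)
qed

text \<open>A label \<open>(c, S)\<close> consists of a cell \<open>c\<close> and of independent uniform signs, where \<open>S\<close> is the set
  of indices of the negative ones.\<close>

definition block_sign :: "(nat \<Rightarrow> nat) \<Rightarrow> nat \<times> nat set \<Rightarrow> real"
  where "block_sign \<kappa> e = rademacher (\<kappa> (fst e)) (snd e)"

text \<open>Division of \<open>j - 1\<close> by \<open>s\<close> encodes a pair: the remainder is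
  the cell supporting the feature, the quotient the number of its Rademacher function. A cell has
  mass \<open>1 / s\<close>, hence the normalisation \<open>sqrt s\<close>.\<close>

definition block_feature :: "nat \<Rightarrow> nat \<Rightarrow> nat \<times> nat set \<Rightarrow> real"
  where "block_feature s j e =
    (if fst e = (j - 1) mod s then sqrt s * rademacher ((j - 1) div s) (snd e) else 0)"

lemma block_sign_cases: "block_sign \<kappa> e \<in> {1, -1}"
  by (simp add: block_sign_def rademacher_def)

text \<open>Within a cell the two signs coincide if the choices agree and are uncorrelated
  otherwise. Divided by the number \<open>s * 2 ^ K\<close> of labels, the sum is the fraction of
  cells in agreement; in particular correlations are never negative.\<close>

lemma sum_block_sign_mult:
  assumes "\<kappa> \<in> {..<s} \<rightarrow> {..<K}" "\<kappa>' \<in> {..<s} \<rightarrow> {..<K}"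
  shows "(\<Sum>e\<in>{..<s} \<times> Pow {..<K}. block_sign \<kappa> e * block_sign \<kappa>' e)
    = 2 ^ K * real (card {c\<in>{..<s}. \<kappa> c = \<kappa>' c})"
proof -
  have "(\<Sum>e\<in>{..<s} \<times> Pow {..<K}. block_sign \<kappa> e * block_sign \<kappa>' e)
      = (\<Sum>c<s. \<Sum>S\<in>Pow {..<K}. rademacher (\<kappa> c) S * rademacher (\<kappa>' c) S)"
    by (simp add: block_sign_def sum.cartesian_product case_prod_beta)
  also have "\<dots> = (\<Sum>c<s. if \<kappa> c = \<kappa>' c then 2 ^ K else 0)"
    using assms by (intro sum.cong refl) (subst sum_rademacher_mult; auto)
  also have "\<dots> = 2 ^ K * real (card {c\<in>{..<s}. \<kappa> c = \<kappa>' c})"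
    by (simp add: sum.inter_filter[symmetric])
  finally show ?thesis .
qed

text \<open>Features of different cells have disjoint supports; two features of the same cell carry
  different Rademacher functions unless they are equal.\<close>

lemma sum_block_feature_mult:
  assumes s: "s > 0" and ij: "i \<in> {1..K}" "j \<in> {1..K}"
  shows "(\<Sum>e\<in>{..<s} \<times> Pow {..<K}. block_feature s i e * block_feature s j e)
    = (if i = j then real s * 2 ^ K else 0)"
proof -
  have dm: "i = j \<longleftrightarrow> (i - 1) mod s = (j - 1) mod s \<and> (i - 1) div s = (j - 1) div s"
  proof
    assume "(i - 1) mod s = (j - 1) mod s \<and> (i - 1) div s = (j - 1) div s"
    then have "i - 1 = j - 1" by (metis div_mult_mod_eq)
    then show "i = j" using ij by (simp only: atLeastAtMost_iff) arith
  qed simp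
  have lt: "(i - 1) div s < K" "(j - 1) div s < K"
    using ij by (auto intro!: le_less_trans[OF div_le_dividend])
  let ?r = "\<Sum>S\<in>Pow {..<K}. rademacher ((i - 1) div s) S * rademacher ((j - 1) div s) S"
  have "(\<Sum>e\<in>{..<s} \<times> Pow {..<K}. block_feature s i e * block_feature s j e)
      = (\<Sum>c<s. \<Sum>S\<in>Pow {..<K}. block_feature s i (c, S) * block_feature s j (c, S))"
    by (simp add: sum.cartesian_product case_prod_beta)
  also have "\<dots> = (\<Sum>c<s. if c = (i - 1) mod s then
      (if (i - 1) mod s = (j - 1) mod s then s * ?r else 0) else 0)"
    by (intro sum.cong refl) (auto simp: block_feature_def sum_distrib_left intro!: sum.cong)
  also have "\<dots> = (if (i - 1) mod s = (j - 1) mod s then s * ?r else 0)"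
    using s by (subst sum.delta) auto
  also have "\<dots> = (if i = j then real s * 2 ^ K else 0)"
    using lt by (subst sum_rademacher_mult) (auto simp: dm)
  finally show ?thesis .
qed

lemma orthonormal_block_features:
  fixes N :: "real ^ 'd::finite \<Rightarrow> nat \<times> nat set"
  assumes s: "s > 0"
    and N: "\<And>g :: nat \<times> nat set \<Rightarrow> real. (\<lambda>x. g (N x)) \<in> borel_measurable borel"
      "\<And>g :: nat \<times> nat set \<Rightarrow> real. has_bochner_integral cube_unif (\<lambda>x. g (N x))
        ((\<Sum>e\<in>{..<s} \<times> Pow {..<p}. g e) / real (card ({..<s} \<times> Pow {..<p})))"
  shows "orthonormal_features p (\<lambda>j x. block_feature s j (N x))"
  unfolding orthonormal_features_def
proof (intro conjI ballI)
  show "(\<lambda>x. block_feature s j (N x)) \<in> borel_measurable borel" for j by (rule N(1))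
  fix i j assume ij: "i \<in> {1..p}" "j \<in> {1..p}"
  show "has_bochner_integral cube_unif (\<lambda>x. block_feature s i (N x) * block_feature s j (N x)) (if i = j then 1 else 0)"
    using N(2)[of "\<lambda>e. block_feature s i e * block_feature s j e"] s
    unfolding sum_block_feature_mult[OF s ij]
    by (auto simp: card_cartesian_product card_Pow split: if_splits)
qed

text \<open>On each cell the pattern is a multiple of a single feature, so one feature per cell
  reproduces it. Because the cells are disjoint, adding \<open>s\<close> features does not enlarge
  the supremum. \<open>s * M \<le> p\<close> guarantees that Rademacher functions numbered below
  \<open>M\<close> are available in every cell.\<close>

lemma block_sign_sparse:
  fixes N :: "real ^ 'd::finite \<Rightarrow> nat \<times> nat set"
  assumes s: "s > 0" and p: "s * M \<le> p" and \<kappa>: "\<kappa> \<in> {..<s} \<rightarrow> {..<M}" and A: "\<bar>A\<bar> \<le> 3"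
    and N: "\<And>x. fst (N x) < s" "\<And>g :: nat \<times> nat set \<Rightarrow> real. (\<lambda>x. g (N x)) \<in> borel_measurable borel"
  shows "(\<lambda>x. A * block_sign \<kappa> (N x)) \<in> sparse_class (\<lambda>j x. block_feature s j (N x)) p s"
  unfolding sparse_class_def
proof (intro CollectI conjI exI)
  show "(\<lambda>x. A * block_sign \<kappa> (N x)) \<in> bdd_class"
    using N(2)[of "\<lambda>e. A * block_sign \<kappa> e"] A by (auto simp: bdd_class_def block_sign_def rademacher_def abs_mult)
  \<comment> \<open>\<open>?j\<close> inverts the numbering used by \<open>block_feature\<close>,
    with 1 added because features are counted from 1; the coefficient \<open>A / sqrt s\<close>
    undoes the normalisation.\<close>
  let ?j = "\<lambda>c. \<kappa> c * s + c + 1"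
  let ?\<alpha> = "\<lambda>j. if (j - 1) div s = \<kappa> ((j - 1) mod s) then A / sqrt s else 0"
  have jp: "?j c \<in> {1..p}" if "c < s" for c
  proof -
    have "\<kappa> c * s + c + 1 \<le> \<kappa> c * s + s" using that by simp
    also have "\<dots> = s * Suc (\<kappa> c)" by simp
    also have "\<dots> \<le> s * M" using \<kappa> that by (intro mult_le_mono) (auto simp: Suc_le_eq)
    finally show ?thesis using p by simp
  qed
  have jeq: "j = ?j ((j - 1) mod s)" if "j \<ge> 1" "(j - 1) div s = \<kappa> ((j - 1) mod s)" for j
    using that div_mult_mod_eq[of "j - 1" s] by simp
  have "{j\<in>{1..p}. ?\<alpha> j \<noteq> 0} \<subseteq> ?j ` {..<s}"
  proof
    fix j assume "j \<in> {j\<in>{1..p}. ?\<alpha> j \<noteq> 0}"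
    then have "j \<ge> 1" "(j - 1) div s = \<kappa> ((j - 1) mod s)" by (auto split: if_splits)
    from jeq[OF this] show "j \<in> ?j ` {..<s}" using s by (intro image_eqI[of _ _ "(j - 1) mod s"]) auto
  qed
  then have "card {j\<in>{1..p}. ?\<alpha> j \<noteq> 0} \<le> card (?j ` {..<s})" by (intro card_mono) auto
  also have "\<dots> \<le> s" using card_image_le[of "{..<s}" ?j] by simp
  finally show "card {j\<in>{1..p}. ?\<alpha> j \<noteq> 0} \<le> s" .
  show "(\<lambda>x. A * block_sign \<kappa> (N x)) = (\<lambda>x. \<Sum>j=1..p. ?\<alpha> j * block_feature s j (N x))"
  proof
    fix x
    let ?c = "fst (N x)"
    have "(\<Sum>j=1..p. ?\<alpha> j * block_feature s j (N x))
        = (\<Sum>j=1..p. if j = ?j ?c then A * block_sign \<kappa> (N x) else 0)"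
    proof (intro sum.cong refl)
      fix j assume j: "j \<in> {1..p}"
      show "?\<alpha> j * block_feature s j (N x) = (if j = ?j ?c then A * block_sign \<kappa> (N x) else 0)"
      proof (cases "j = ?j ?c")
        case True
        then have "(j - 1) mod s = ?c" "(j - 1) div s = \<kappa> ?c" using N(1)[of x] by auto
        then show ?thesis using True s by (simp add: block_feature_def block_sign_def)
      next
        case False
        then have "\<not> ((j - 1) mod s = ?c \<and> (j - 1) div s = \<kappa> ((j - 1) mod s))"
          using jeq[of j] j by auto
        then show ?thesis using False by (auto simp: block_feature_def)
      qed
    qed
    also have "\<dots> = A * block_sign \<kappa> (N x)" using jp[OF N(1)[of x]] by simp
    finally show "A * block_sign \<kappa> (N x) = (\<Sum>j=1..p. ?\<alpha> j * block_feature s j (N x))" by simp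
  qed
qed

section \<open>Second moment of the block mixture\<close>

lemma exp_half_le_2: "exp (1 / 2 :: real) \<le> 2"
  using exp_bound[of "1 / 2 :: real"] by (simp add: power2_eq_square)

lemma power_le_exp: "0 \<le> 1 + x \<Longrightarrow> (1 + x) ^ n \<le> exp (real n * x)" for x :: real
  by (simp add: exp_of_nat_mult power_mono)

text \<open>For fixed \<open>w\<close> and uniform \<open>w'\<close>, agreements in different cells
  are independent events of probability \<open>1 / M\<close>. Replacing the power by an exponential
  gives a factor \<open>E\<close> per agreement, so the average is at most
  \<open>(1 + E / M) ^ s\<close>, hence at most \<open>exp (s * E / M)\<close>; \<open>le\<close>
  bounds this exponent by 1/2.\<close>

lemma sum_agreement_power_le:
  fixes q :: real
  assumes s: "s > 0" and M: "M > 0" and q: "q \<ge> 0"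
    and le: "real s * exp (real N * q / real s) \<le> real M / 2"
  defines "W \<equiv> {..<s} \<rightarrow>\<^sub>E {..<M}"
  shows "(\<Sum>w\<in>W. \<Sum>w'\<in>W. (1 + q * (real (card {c\<in>{..<s}. w c = w' c}) / s)) ^ N) \<le> 2 * (real (card W))\<^sup>2"
proof -
  define E where "E = exp (real N * q / real s)"
  have cW: "card W = M ^ s" by (simp add: W_def card_PiE)
  have row: "(\<Sum>w'\<in>W. (1 + q * (real (card {c\<in>{..<s}. w c = w' c}) / s)) ^ N) \<le> 2 * real M ^ s"
    if w: "w \<in> W" for w
  proof -
    have "(1 + q * (real (card {c\<in>{..<s}. w c = w' c}) / s)) ^ N \<le> (\<Prod>c<s. if w c = w' c then E else 1)" for w'
    proof -
      let ?k = "card {c\<in>{..<s}. w c = w' c}"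
      have "(1 + q * (real ?k / s)) ^ N \<le> exp (real N * (q * (real ?k / s)))"
        using q by (intro power_le_exp) simp
      also have "\<dots> = E ^ ?k" by (simp add: E_def exp_of_nat_mult[symmetric] mult_ac)
      also have "\<dots> = (\<Prod>c<s. if w c = w' c then E else 1)"
        by (simp add: prod.inter_filter[symmetric])
      finally show ?thesis .
    qed
    then have "(\<Sum>w'\<in>W. (1 + q * (real (card {c\<in>{..<s}. w c = w' c}) / s)) ^ N)
        \<le> (\<Sum>w'\<in>W. \<Prod>c<s. if w c = w' c then E else 1)"
      by (rule sum_mono)
    also have "\<dots> = (\<Prod>c<s. \<Sum>k<M. if w c = k then E else 1)"
      unfolding W_def by (subst prod_sum_PiE) auto
    also have "\<dots> \<le> (\<Prod>c<s. real M + E)"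
    proof (intro prod_mono conjI)
      fix c assume "c \<in> {..<s}"
      have "(\<Sum>k<M. if w c = k then E else 1) \<le> (\<Sum>k<M. 1 + (if k = w c then E else 0))"
        by (intro sum_mono) auto
      also have "\<dots> \<le> real M + E" unfolding sum.distrib by (simp add: E_def)
      finally show "(\<Sum>k<M. if w c = k then E else 1) \<le> real M + E" .
    qed (auto intro!: sum_nonneg simp: E_def)
    also have "\<dots> = real M ^ s * (1 + E / M) ^ s"
      using M by (simp add: power_mult_distrib[symmetric] field_simps)
    also have "\<dots> \<le> real M ^ s * 2"
    proof (rule mult_left_mono)
      have "(1 + E / M) ^ s \<le> exp (real s * (E / M))" by (intro power_le_exp) (simp add: E_def)
      also have "\<dots> \<le> exp (1 / 2)" using le M by (simp add: E_def field_simps)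
      also note exp_half_le_2
      finally show "(1 + E / M) ^ s \<le> 2" .
    qed simp
    finally show ?thesis by (simp only: mult.commute)
  qed
  have "(\<Sum>w\<in>W. \<Sum>w'\<in>W. (1 + q * (real (card {c\<in>{..<s}. w c = w' c}) / s)) ^ N) \<le> (\<Sum>w\<in>W. 2 * real M ^ s)"
    by (intro sum_mono row)
  also have "\<dots> = 2 * (real (card W))\<^sup>2" by (simp add: cW power2_eq_square)
  finally show ?thesis .
qed

text \<open>Common source of the bounds from the balls and from sparsity. \<open>K\<close> counts
  the signs carried by a label and \<open>M\<close> the functions a pattern may choose from. They
  are kept apart because labels for \<open>p\<close> features carry \<open>p\<close> signs, while
  only \<open>p div s\<close> Rademacher functions are available in every cell.\<close>

lemma minimax_risk_block_mixture:
  fixes L :: "real ^ 'd::finite \<Rightarrow> nat \<times> nat set"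
  assumes s: "s > 0" and M: "M > 0" "M \<le> K"
    and L: "\<And>g :: nat \<times> nat set \<Rightarrow> real. (\<lambda>x. g (L x)) \<in> borel_measurable borel"
      "\<And>g :: nat \<times> nat set \<Rightarrow> real. has_bochner_integral cube_unif (\<lambda>x. g (L x))
        ((\<Sum>e\<in>{..<s} \<times> Pow {..<K}. g e) / real (card ({..<s} \<times> Pow {..<K})))"
    and ab: "a\<^sup>2 \<le> 2 / 3" "\<bar>a * b\<bar> + \<bar>b\<bar> \<le> 1"
    and F: "F\<^sub>\<mu> \<subseteq> bdd_class" "F\<^sub>\<pi> \<subseteq> bdd_class" "(\<lambda>x. 0) \<in> F\<^sub>\<mu>" "(\<lambda>x. 0) \<in> F\<^sub>\<pi>"
      "\<And>\<kappa>. \<kappa> \<in> {..<s} \<rightarrow> {..<M} \<Longrightarrow> (\<lambda>x. b * block_sign \<kappa> (L x)) \<in> F\<^sub>\<mu>"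
      "\<And>\<kappa>. \<kappa> \<in> {..<s} \<rightarrow> {..<M} \<Longrightarrow> (\<lambda>x. a * block_sign \<kappa> (L x)) \<in> F\<^sub>\<pi>"
    and le: "real s * exp (real N * (a\<^sup>2 + b\<^sup>2) / real s) \<le> real M / 2"
  shows "minimax_risk N (plm_family F\<^sub>\<mu> F\<^sub>\<pi>) target \<ge> ennreal (\<bar>a * b\<bar> / 4)"
proof -
  define W where "W = ({..<s} \<rightarrow>\<^sub>E {..<M})"
  define q where "q = a\<^sup>2 + (b + a * (- (a * b)))\<^sup>2"
  have WK: "w \<in> {..<s} \<rightarrow> {..<M}" "w \<in> {..<s} \<rightarrow> {..<K}" if "w \<in> W" for w
  proof -
    show w: "w \<in> {..<s} \<rightarrow> {..<M}" using that by (auto simp: W_def)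
    show "w \<in> {..<s} \<rightarrow> {..<K}"
    proof (rule Pi_I)
      fix c assume "c \<in> {..<s}"
      from Pi_mem[OF w this] M(2) show "w c \<in> {..<K}" by simp
    qed
  qed
  have W: "finite W" "W \<noteq> {}" using M by (auto simp: W_def PiE_eq_empty_iff intro!: finite_PiE)
  \<comment> \<open>Cancelling the TY term shrinks the coefficient of Y from \<open>b\<close> to
    \<open>b * (1 - a\<^sup>2)\<close>, which yields
    \<open>q \<le> a\<^sup>2 + b\<^sup>2\<close>.\<close>
  have "b + a * (- (a * b)) = b * (1 - a\<^sup>2)" by (simp add: power2_eq_square algebra_simps)
  moreover have "(1 - a\<^sup>2)\<^sup>2 \<le> 1" using ab(1) zero_le_power2[of a] by (intro power_le_one) auto
  ultimately have "(b + a * (- (a * b)))\<^sup>2 \<le> b\<^sup>2" by (simp add: power_mult_distrib mult_left_le)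
  then have q: "0 \<le> q" "q \<le> a\<^sup>2 + b\<^sup>2" by (simp_all add: q_def)
  have "real s * exp (real N * q / real s) \<le> real s * exp (real N * (a\<^sup>2 + b\<^sup>2) / real s)"
    using q by (intro mult_left_mono) (auto intro!: divide_right_mono mult_left_mono)
  then have le': "real s * exp (real N * q / real s) \<le> real M / 2" using le by linarith
  have int: "(\<integral>x. block_sign w (L x) * block_sign w' (L x) \<partial>cube_unif)
      = real (card {c\<in>{..<s}. w c = w' c}) / s" if "w \<in> W" "w' \<in> W" for w w'
    using has_bochner_integral_integral_eq[OF L(2)[of "\<lambda>e. block_sign w e * block_sign w' e"]]
    unfolding sum_block_sign_mult[OF WK(2)[OF that(1)] WK(2)[OF that(2)]]
    by (simp add: card_cartesian_product card_Pow)
  have "ennreal (\<bar>- (a * b)\<bar> / 4) \<le> minimax_risk N (plm_family F\<^sub>\<mu> F\<^sub>\<pi>) target"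
  proof (rule minimax_risk_sign_mixture[OF W, where h = "\<lambda>w x. block_sign w (L x)"])
    show "(\<Sum>w\<in>W. \<Sum>w'\<in>W. (1 + (- (a * b) + a * b)\<^sup>2 + (a\<^sup>2 + (b + a * (- (a * b)))\<^sup>2)
        * (\<integral>x. block_sign w (L x) * block_sign w' (L x) \<partial>cube_unif)) ^ N) \<le> 2 * (real (card W))\<^sup>2"
      using sum_agreement_power_le[OF s M(1) q(1) le'] unfolding W_def[symmetric] q_def[symmetric]
      by (simp add: int)
  qed (use L(1) block_sign_cases ab F WK in auto)
  then show ?thesis by simp
qed

section \<open>The three lower bounds\<close>

lemma zero_in_L2_ball: "0 \<le> \<delta> \<Longrightarrow> (\<lambda>x. 0) \<in> L2_ball (\<lambda>_. 0 :: real) \<delta>"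
  by (simp add: L2_ball_def L2_dist_def bdd_class_def)

lemma scaled_sign_in_L2_ball:
  fixes h :: "real ^ 'd::finite \<Rightarrow> real"
  assumes h: "h \<in> borel_measurable borel" "\<And>x. h x \<in> {1, -1}" and \<delta>: "0 \<le> \<delta>" "\<delta> \<le> 3"
  shows "(\<lambda>x. \<delta> * h x) \<in> L2_ball (\<lambda>_. 0) \<delta>"
proof -
  interpret C: prob_space "cube_unif :: (real ^ 'd) measure" by (rule prob_space_cube_unif)
  note [measurable] = h(1)
  have h2: "(h x)\<^sup>2 = 1" "\<bar>h x\<bar> = 1" for x using h(2)[of x] by auto
  show ?thesis
    using \<delta> C.prob_space by (simp add: L2_ball_def L2_dist_def bdd_class_def power_mult_distrib abs_mult h2)
qed

lemma minimax_risk_parametric: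
  fixes F\<^sub>\<mu> F\<^sub>\<pi> :: "(real ^ 'd::finite \<Rightarrow> real) set"
  assumes n: "n > 0"
    and F: "F\<^sub>\<mu> \<subseteq> bdd_class" "F\<^sub>\<pi> \<subseteq> bdd_class" "(\<lambda>x. 0) \<in> F\<^sub>\<mu>" "(\<lambda>x. 0) \<in> F\<^sub>\<pi>"
  shows "minimax_risk (2 * n) (plm_family F\<^sub>\<mu> F\<^sub>\<pi>) target \<ge> ennreal (1 / sqrt n / 8)"
proof -
  \<comment> \<open>One alternative suffices here: for a = b = 0 the pattern drops out and the
    second moment is \<open>(1 + \<beta>\<^sup>2) ^ (2 * n)\<close>. This \<beta> makes the exponent
    \<open>2 * n * \<beta>\<^sup>2\<close> equal to 1/2.\<close>
  define \<beta> where "\<beta> = 1 / sqrt n / 2"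
  have "1 / sqrt n \<le> 1" using n by simp
  moreover have "u / 2 \<le> 1" if "u \<le> 1" for u :: real using that by simp
  ultimately have \<beta>1: "\<beta> \<le> 1" unfolding \<beta>_def by blast
  have \<beta>0: "0 \<le> \<beta>" by (simp add: \<beta>_def)
  have "\<beta>\<^sup>2 = 1 / (4 * n)" by (simp add: \<beta>_def power_divide)
  then have "(1 + \<beta>\<^sup>2) ^ (2 * n) \<le> exp (1 / 2)"
    using power_le_exp[of "\<beta>\<^sup>2" "2 * n"] n by (simp add: add_nonneg_nonneg)
  then have "(1 + \<beta>\<^sup>2) ^ (2 * n) \<le> 2" using exp_half_le_2 by linarith
  then have "ennreal (\<bar>\<beta>\<bar> / 4) \<le> minimax_risk (2 * n) (plm_family F\<^sub>\<mu> F\<^sub>\<pi>) target"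
    by (intro minimax_risk_sign_mixture[where W = "{()}" and h = "\<lambda>_ _. 1" and a = 0 and b = 0])
      (use \<beta>0 \<beta>1 F in auto)
  also have "\<bar>\<beta>\<bar> / 4 = 1 / sqrt n / 8" using \<beta>0 by (simp add: \<beta>_def)
  finally show ?thesis .
qed

text \<open>A single cell is used, so two random patterns are orthogonal except with probability
  \<open>1 / M\<close>. A sign pattern scaled by the radius lies in the ball however fine it is, so
  \<open>M\<close> may grow exponentially in \<open>N\<close> and the bound does not decay with the
  sample size.\<close>

lemma minimax_risk_L2_balls:
  fixes F\<^sub>\<mu> F\<^sub>\<pi> :: "(real ^ 'd::finite \<Rightarrow> real) set"
  assumes \<delta>: "\<delta>\<^sub>\<mu> \<in> {0..1/3}" "\<delta>\<^sub>\<pi> \<in> {0..1/3}"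
    and F: "F\<^sub>\<mu> \<subseteq> bdd_class" "F\<^sub>\<pi> \<subseteq> bdd_class"
      "L2_ball (\<lambda>_. 0) \<delta>\<^sub>\<mu> \<subseteq> F\<^sub>\<mu>" "L2_ball (\<lambda>_. 0) \<delta>\<^sub>\<pi> \<subseteq> F\<^sub>\<pi>"
  shows "minimax_risk N (plm_family F\<^sub>\<mu> F\<^sub>\<pi>) target \<ge> ennreal (\<delta>\<^sub>\<mu> * \<delta>\<^sub>\<pi> / 4)"
proof -
  define M where "M = nat \<lceil>2 * exp (real N * (\<delta>\<^sub>\<pi>\<^sup>2 + \<delta>\<^sub>\<mu>\<^sup>2))\<rceil>"
  have Mle: "2 * exp (real N * (\<delta>\<^sub>\<pi>\<^sup>2 + \<delta>\<^sub>\<mu>\<^sup>2)) \<le> real M" unfolding M_def by linarith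
  have M: "M > 0" by (rule ccontr) (use Mle exp_gt_zero[of "real N * (\<delta>\<^sub>\<pi>\<^sup>2 + \<delta>\<^sub>\<mu>\<^sup>2)"] in simp)
  obtain L :: "real ^ 'd \<Rightarrow> nat \<times> nat set" where
    L: "\<And>g :: nat \<times> nat set \<Rightarrow> real. (\<lambda>x. g (L x)) \<in> borel_measurable borel"
      "\<And>g :: nat \<times> nat set \<Rightarrow> real. has_bochner_integral cube_unif (\<lambda>x. g (L x))
        ((\<Sum>e\<in>{..<1} \<times> Pow {..<M}. g e) / real (card ({..<1::nat} \<times> Pow {..<M})))"
    by (rule uniform_cube_label[of "{..<1::nat} \<times> Pow {..<M}"]) auto
  have sq: "\<delta>\<^sup>2 \<le> 2 / 3" "\<delta> * \<delta>' + \<delta>' \<le> 1" if "\<delta> \<in> {0..1/3}" "\<delta>' \<in> {0..1/3}" for \<delta> \<delta>' :: real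
    using that mult_mono[of \<delta> "1/3" \<delta> "1/3"] mult_mono[of \<delta> "1/3" \<delta>' "1/3"] by (auto simp: power2_eq_square)
  have "ennreal (\<bar>\<delta>\<^sub>\<pi> * \<delta>\<^sub>\<mu>\<bar> / 4) \<le> minimax_risk N (plm_family F\<^sub>\<mu> F\<^sub>\<pi>) target"
  proof (rule minimax_risk_block_mixture[OF _ M order.refl L])
    have "(\<lambda>x. \<delta> * block_sign \<kappa> (L x)) \<in> L2_ball (\<lambda>_. 0) \<delta>" if "0 \<le> \<delta>" "\<delta> \<le> 3" for \<delta> \<kappa>
      by (rule scaled_sign_in_L2_ball[OF L(1) block_sign_cases that])
    then show "(\<lambda>x. \<delta>\<^sub>\<mu> * block_sign \<kappa> (L x)) \<in> F\<^sub>\<mu>" "(\<lambda>x. \<delta>\<^sub>\<pi> * block_sign \<kappa> (L x)) \<in> F\<^sub>\<pi>" for \<kappa>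
      using \<delta> F(3,4) by (auto intro!: subsetD[OF F(3)] subsetD[OF F(4)])
    show "(\<lambda>x. 0) \<in> F\<^sub>\<mu>" "(\<lambda>x. 0) \<in> F\<^sub>\<pi>"
      using zero_in_L2_ball \<delta> F(3,4) by auto
    show "real 1 * exp (real N * (\<delta>\<^sub>\<pi>\<^sup>2 + \<delta>\<^sub>\<mu>\<^sup>2) / real 1) \<le> real M / 2" using Mle by simp
    show "\<delta>\<^sub>\<pi>\<^sup>2 \<le> 2 / 3" "\<bar>\<delta>\<^sub>\<pi> * \<delta>\<^sub>\<mu>\<bar> + \<bar>\<delta>\<^sub>\<mu>\<bar> \<le> 1" using sq[OF \<delta>(2,1)] \<delta> by auto
  qed (use F in auto)
  then show ?thesis using \<delta> by (simp add: mult.commute)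
qed

text \<open>Amplitude \<open>A\<^sup>2 = s ln p / (12 n)\<close> makes the agreement of two sign patterns on a single cell
  contribute a factor of at most \<open>p powr (1/3)\<close>, against \<open>p div s\<close> choices per cell.\<close>

lemma minimax_risk_sparse:
  fixes F\<^sub>\<mu> F\<^sub>\<pi> :: "(real ^ 'd::finite \<Rightarrow> real) set"
  assumes s: "s > 0" "s \<le> p" and sn: "real s * (ln (real p / real s) + 1) \<le> real n"
    and np: "real n \<le> real p powr (1/3)"
    and L: "\<And>x. fst (L x) < s" "\<And>g :: nat \<times> nat set \<Rightarrow> real. (\<lambda>x. g (L x)) \<in> borel_measurable borel"
      "\<And>g :: nat \<times> nat set \<Rightarrow> real. has_bochner_integral cube_unif (\<lambda>x. g (L x))
        ((\<Sum>e\<in>{..<s} \<times> Pow {..<p}. g e) / real (card ({..<s} \<times> Pow {..<p})))"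
    and F: "F\<^sub>\<mu> \<subseteq> bdd_class" "F\<^sub>\<pi> \<subseteq> bdd_class" "(\<lambda>x. 0) \<in> F\<^sub>\<mu>" "(\<lambda>x. 0) \<in> F\<^sub>\<pi>"
      "sparse_class (\<lambda>j x. block_feature s j (L x)) p s \<subseteq> F\<^sub>\<mu>"
      "sparse_class (\<lambda>j x. block_feature s j (L x)) p s \<subseteq> F\<^sub>\<pi>"
  shows "minimax_risk (2 * n) (plm_family F\<^sub>\<mu> F\<^sub>\<pi>) target \<ge> ennreal (real s * ln (real p) / real n / 48)"
proof (cases "p = 1")
  case False
  then have p: "p \<ge> 2" using s by simp
  have lnps: "0 \<le> ln (real p / real s)" using s by simp
  have "real s * 1 \<le> real s * (ln (real p / real s) + 1)" using lnps by (intro mult_left_mono) auto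
  then have sn1: "real s \<le> n" using sn by simp
  define r where "r = real p powr (1/3)"
  have r3: "r ^ 3 = p" using p by (simp add: r_def powr_power)
  have r0: "r > 0" using p by (simp add: r_def)
  have sr: "real s \<le> r" using sn1 np by (simp add: r_def)
  \<comment> \<open>Otherwise s = n = 1 and the sample size condition reads
    \<open>ln p + 1 \<le> 1\<close>, against \<open>p \<ge> 2\<close>.\<close>
  have n2: "n \<ge> 2"
  proof (rule ccontr)
    assume "\<not> n \<ge> 2"
    then have "s = 1" "n = 1" using sn1 s by auto
    then show False using sn p by simp
  qed
  have r2: "r \<ge> 2" using np n2 by (simp add: r_def)
  have psr: "real p / s \<ge> r\<^sup>2"
  proof -
    have "r\<^sup>2 * s \<le> r\<^sup>2 * r" using sr by (intro mult_left_mono) auto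
    then show ?thesis using r3 s by (simp add: field_simps power2_eq_square power3_eq_cube)
  qed
  have lnp: "ln (real p) = 3 * ln r" unfolding r3[symmetric] using r0 by (simp add: ln_realpow)
  have "ln (r\<^sup>2) \<le> ln (real p / s)" using psr r0 s p by (subst ln_le_cancel_iff) auto
  then have lnr: "2 * ln r \<le> ln (real p / s)" using r0 by (simp add: ln_realpow)
  \<comment> \<open>The crude bound \<open>s \<le> r\<close> is improved: it gave
    \<open>ln (p / s) \<ge> 2 * ln r\<close>, which is at least 1, so the sample size condition now
    yields \<open>2 * s \<le> n\<close>, hence \<open>2 * s \<le> r\<close>. The gained factor 2
    pays for rounding in \<open>p div s\<close> and for the 1/2 in the moment condition.\<close>
  have "(1::real) \<le> 2 * ln 2" using exp_half_le_2 ln_ge_iff[of 2 "1 / 2 :: real"] by simp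
  also have "\<dots> \<le> 2 * ln r" using r2 by simp
  finally have "1 \<le> ln (real p / s)" using lnr by linarith
  then have "real s * 2 \<le> real s * (ln (real p / s) + 1)" by (intro mult_left_mono) auto
  then have s2: "2 * real s \<le> r" using sn np by (simp add: r_def)
  have "real s * (2 * ln r) \<le> real s * (ln (real p / s) + 1)" using lnr by (intro mult_left_mono) auto
  then have slnr: "2 * (real s * ln r) \<le> n" using sn by simp
  define M where "M = p div s"
  have sM: "s * M \<le> p" by (simp add: M_def)
  have "real p / s < real M + 1"
  proof -
    have "p < s * (M + 1)" using s unfolding M_def by (simp add: dividend_less_times_div)
    then have "real p < real (s * (M + 1))" by (simp only: of_nat_less_iff)
    then show ?thesis using s by (simp add: field_simps)
  qed
  moreover have "r\<^sup>2 \<ge> 2\<^sup>2" using r2 by (intro power_mono) auto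
  ultimately have M1: "real M > r\<^sup>2 - 1" "r\<^sup>2 \<ge> 4" using psr by auto
  then have M0: "M > 0" by (intro gr0I) auto
  have psr2: "real p / s \<ge> 2 * r\<^sup>2"
  proof -
    have "r\<^sup>2 * (2 * s) \<le> r\<^sup>2 * r" using s2 by (intro mult_left_mono) auto
    then show ?thesis using r3 s by (simp add: field_simps power2_eq_square power3_eq_cube)
  qed
  \<comment> \<open>Rounding loses less than 1, and
    \<open>2 * r\<^sup>2 - 1 \<ge> r\<^sup>2\<close>.\<close>
  then have Mr: "real M \<ge> r\<^sup>2" using \<open>real p / s < real M + 1\<close> M1(2) by linarith
  define A where "A = sqrt (real s * ln r / (4 * n))"
  have lr: "ln r \<ge> 0" using r2 by simp
  have A2: "A\<^sup>2 = real s * ln r / (4 * n)" using lr by (simp add: A_def)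
  have A18: "A\<^sup>2 \<le> 1 / 8" using slnr n2 unfolding A2 by (simp add: divide_simps)
  have A0: "A \<ge> 0" using lr by (simp add: A_def)
  have A12: "A \<le> 1 / 2" using A18 A0 by (intro power2_le_imp_le[of A "1/2"]) (auto simp: power2_eq_square)
  \<comment> \<open>The amplitude is tuned so that the exponent
    \<open>2 * n * (2 * A\<^sup>2) / s\<close> is exactly \<open>ln r\<close>.\<close>
  have "real s * exp (real (2 * n) * (A\<^sup>2 + A\<^sup>2) / real s) = real s * r"
    using n2 s r0 by (simp add: A2)
  also have "\<dots> \<le> r / 2 * r" using s2 r0 by (intro mult_right_mono) auto
  also have "\<dots> \<le> real M / 2" using Mr by (simp add: power2_eq_square)
  finally have le: "real s * exp (real (2 * n) * (A\<^sup>2 + A\<^sup>2) / real s) \<le> real M / 2" .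
  have "ennreal (\<bar>A * A\<bar> / 4) \<le> minimax_risk (2 * n) (plm_family F\<^sub>\<mu> F\<^sub>\<pi>) target"
  proof (rule minimax_risk_block_mixture[OF s(1) M0 _ L(2,3) _ _ F(1-4) _ _ le])
    show "M \<le> p" by (simp add: M_def)
    show "A\<^sup>2 \<le> 2 / 3" "\<bar>A * A\<bar> + \<bar>A\<bar> \<le> 1" using A18 A12 A0 by (auto simp: power2_eq_square)
    show "(\<lambda>x. A * block_sign \<kappa> (L x)) \<in> F\<^sub>\<mu>" "(\<lambda>x. A * block_sign \<kappa> (L x)) \<in> F\<^sub>\<pi>"
      if "\<kappa> \<in> {..<s} \<rightarrow> {..<M}" for \<kappa>
      using block_sign_sparse[where N = L and A = A, OF s(1) sM that _ L(1,2)] A0 A12 F(5,6) by auto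
  qed
  \<comment> \<open>48 collects 4 from the two-point method, 4 from the amplitude and 3 from
    \<open>ln p = 3 * ln r\<close>.\<close>
  also have "\<bar>A * A\<bar> / 4 = real s * ln (real p) / real n / 48"
    using A2 lr by (simp add: power2_eq_square lnp)
  finally show ?thesis .
qed simp

theorem mainTheorem3:
  fixes \<delta>\<^sub>\<mu> \<delta>\<^sub>\<pi> :: real and n p s :: nat
  assumes "\<delta>\<^sub>\<mu> \<in> {0..<1/3}" and "\<delta>\<^sub>\<pi> \<in> {0..<1/3}"
    and "p > 0" and "s > 0" and "s \<le> p"
    and "real s * (ln (real p / real s) + 1) \<le> real n"
    and "real n \<le> real p powr (1/3)"
  shows "\<exists>\<phi> :: nat \<Rightarrow> real ^ 'd::finite \<Rightarrow> real.
    orthonormal_features p \<phi> \<and>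
    minimax_risk (2 * n)
      (plm_family (sparse_class \<phi> p s \<union> L2_ball (\<lambda>_. 0) \<delta>\<^sub>\<mu>)
                  (sparse_class \<phi> p s \<union> L2_ball (\<lambda>_. 0) \<delta>\<^sub>\<pi>))
      target
    \<ge> ennreal (1/211 * (real n powr (-1/2) + \<delta>\<^sub>\<mu> * \<delta>\<^sub>\<pi> + real s * ln (real p) / real n))"
proof -
  \<comment> \<open>\<open>p\<close> signs per label are enough, since the quotients
    \<open>(j - 1) div s\<close> are below \<open>p\<close>.\<close>
  obtain L :: "real ^ 'd \<Rightarrow> nat \<times> nat set" where
    L: "\<And>x. L x \<in> {..<s} \<times> Pow {..<p}" "\<And>g :: nat \<times> nat set \<Rightarrow> real. (\<lambda>x. g (L x)) \<in> borel_measurable borel"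
      "\<And>g :: nat \<times> nat set \<Rightarrow> real. has_bochner_integral cube_unif (\<lambda>x. g (L x))
        ((\<Sum>e\<in>{..<s} \<times> Pow {..<p}. g e) / real (card ({..<s} \<times> Pow {..<p})))"
    by (rule uniform_cube_label[of "{..<s} \<times> Pow {..<p}"]) (use assms(4) in auto)
  define \<phi> where "\<phi> j x = block_feature s j (L x)" for j x
  define F where "F \<delta> = sparse_class \<phi> p s \<union> L2_ball (\<lambda>_. 0) \<delta>" for \<delta>
  have F: "F \<delta> \<subseteq> bdd_class" "L2_ball (\<lambda>_. 0) \<delta> \<subseteq> F \<delta>" "sparse_class \<phi> p s \<subseteq> F \<delta>" for \<delta>
    by (auto simp: F_def sparse_class_def L2_ball_def)
  have F0: "(\<lambda>x. 0) \<in> F \<delta>\<^sub>\<mu>" "(\<lambda>x. 0) \<in> F \<delta>\<^sub>\<pi>"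
    using zero_in_L2_ball assms(1,2) F(2) by auto
  have orth: "orthonormal_features p \<phi>"
    unfolding \<phi>_def[abs_def] using assms(4) L by (intro orthonormal_block_features) auto
  have "0 < real s * (ln (real p / real s) + 1)"
    using assms(4,5) by (intro mult_pos_pos add_nonneg_pos) auto
  then have n: "n > 0" using assms(6) by simp
  define R where "R = minimax_risk (2 * n) (plm_family (F \<delta>\<^sub>\<mu>) (F \<delta>\<^sub>\<pi>)) target"
  define a b c where "a = 1 / sqrt n" and "b = \<delta>\<^sub>\<mu> * \<delta>\<^sub>\<pi>" and "c = real s * ln (real p) / real n"
  have R: "ennreal (a / 8) \<le> R" "ennreal (b / 4) \<le> R" "ennreal (c / 48) \<le> R"
    unfolding R_def a_def b_def c_def
  proof -
    show "ennreal (1 / sqrt n / 8) \<le> minimax_risk (2 * n) (plm_family (F \<delta>\<^sub>\<mu>) (F \<delta>\<^sub>\<pi>)) target"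
      by (rule minimax_risk_parametric[OF n F(1,1) F0])
    show "ennreal (\<delta>\<^sub>\<mu> * \<delta>\<^sub>\<pi> / 4) \<le> minimax_risk (2 * n) (plm_family (F \<delta>\<^sub>\<mu>) (F \<delta>\<^sub>\<pi>)) target"
      using assms(1,2) by (intro minimax_risk_L2_balls F) auto
    show "ennreal (real s * ln (real p) / real n / 48)
        \<le> minimax_risk (2 * n) (plm_family (F \<delta>\<^sub>\<mu>) (F \<delta>\<^sub>\<pi>)) target"
      using L by (intro minimax_risk_sparse[OF assms(4-7), where L = L] F F0 F(3)[unfolded \<phi>_def[abs_def]])
        (auto simp: mem_Times_iff)
  qed
  have nonneg: "0 \<le> a" "0 \<le> b" "0 \<le> c"
    using assms by (simp_all add: a_def b_def c_def)
  \<comment> \<open>If m is the maximum, then a, b and c are at most 8 m, 4 m and 48 m, so their sum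
    is at most 60 m.\<close>
  have "1 / 211 * (a + b + c) \<le> max (a / 8) (max (b / 4) (c / 48))"
    using nonneg by (simp add: max_def)
  then have "ennreal (1 / 211 * (a + b + c)) \<le> ennreal (max (a / 8) (max (b / 4) (c / 48)))"
    by (rule ennreal_leI)
  also have "\<dots> \<le> R" using R by (simp add: max_def)
  finally have "ennreal (1 / 211 * (a + b + c)) \<le> R" .
  with orth have "orthonormal_features p \<phi> \<and> ennreal (1 / 211 * (a + b + c)) \<le> R" by simp
  moreover have "real n powr (-1/2) = a"
    using n by (simp add: a_def powr_minus_divide powr_half_sqrt)
  ultimately show ?thesis unfolding R_def F_def b_def c_def by metis
qed

end
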